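(* Let $A$ be a ring, $\mathcal{C}$ an $A$-coring and $M$ a left $\mathcal{C}$-comodule. Put $T={}^{\mathcal{C}}\mathrm{End}(M)^{\mathrm{op}}$, ${}^*\mathcal{C}={}_A\mathrm{Hom}(\mathcal{C},A)$, ${}^*M={}_A\mathrm{Hom}(M,A)$ and $Q={}^{\mathcal{C}}\mathrm{Hom}(\mathcal{C},M)$, with the actions $$(\varphi\cdot f)(m)=f(m_{[-1]}\varphi(m_{[0]})),\quad t\cdot\varphi=\varphi\circ t,\quad (f\cdot q)(c)=q(c_{(1)}f(c_{(2)})),\quad q\cdot t=t\circ q$$ for $\varphi\in{}^*M$, $f\in{}^*\mathcal{C}$, $t\in T$, $q\in Q$, $m\in M$, $c\in\mathcal{C}$, and the maps $$\mu:Q\otimes_T{}^*M\to{}^*\mathcal{C},\ \mu(q\otimes\varphi)=\varphi\circ q;\qquad \tau:{}^*M\otimes_{{}^*\mathcal{C}}Q\to T,\ \tau(\varphi\otimes q)(m)=q(m_{[-1]}\varphi(m_{[0]})).$$ Then $(T,{}^*\mathcal{C},{}^*M,Q,\tau,\mu)$ is a Morita context.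
   Context: An $A$-coring is an $A$-bimodule $\mathcal{C}$ with $A$-bimodule maps $\Delta:\mathcal{C}\to\mathcal{C}\otimes_A\mathcal{C}$, $\Delta(c)=c_{(1)}\otimes_A c_{(2)}$ (coassociative) and $\varepsilon:\mathcal{C}\to A$ (counit). A left $\mathcal{C}$-comodule is a left $A$-module $M$ with a left $A$-linear, coassociative and counital coaction $M\to\mathcal{C}\otimes_A M$, $m\mapsto m_{[-1]}\otimes_A m_{[0]}$; left $\mathcal{C}$-colinear maps are left $A$-linear maps commuting with coactions, and ${}^{\mathcal{C}}\mathrm{Hom}$, ${}^{\mathcal{C}}\mathrm{End}$ denote the sets of such maps. $\mathcal{C}$ is a left $\mathcal{C}$-comodule via $\Delta$. ${}^*\mathcal{C}$ is a ring with multiplication $(f\#g)(c)=g(c_{(1)}f(c_{(2)}))$ and unit $\varepsilon$. A Morita context $(R,S,P,Q,\tau,\mu)$ consists of rings $R,S$, an $(R,S)$-bimodule $P$, an $(S,R)$-bimodule $Q$, an $R$-bimodule map $\tau:P\otimes_S Q\to R$ and an $S$-bimodule map $\mu:Q\otimes_R P\to S$ such that $\tau(p\otimes q)p'=p\,\mu(q\otimes p')$ and $\mu(q\otimes p)q'=q\,\tau(p\otimes q')$ for all $p,p'\in P$, $q,q'\in Q$. *)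

theory Defs
  imports
    "HOL-Algebra.Module"
    "HOL-Algebra.AbelCoset"
    "HOL-Algebra.Generated_Groups"
    "HOL-Algebra.Free_Abelian_Groups"
begin

section \<open>Modules and bimodules over rings that need not be commutative\<close>

text \<open>The record \<open>module\<close> of HOL-Algebra carries an unused multiplication and unit, and the
  locale \<open>module\<close> asks for a commutative ring; only the record is reused. As there, the ring
  operations are unital and no condition \<open>\<one> \<noteq> \<zero>\<close> is imposed.\<close>

record ('r, 'm, 's) bimodule = "('r, 'm) module" +
  rsmult :: "'m \<Rightarrow> 's \<Rightarrow> 'm"  (infixl \<open>\<triangleleft>\<index>\<close> 70)

locale left_module = R?: ring R + M?: abelian_group M for R (structure) and M (structure) +
  assumes lsmult_closed: "\<lbrakk>r \<in> carrier R; x \<in> carrier M\<rbrakk> \<Longrightarrow> r \<odot>\<^bsub>M\<^esub> x \<in> carrier M"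
    and lsmult_l_distr: "\<lbrakk>r \<in> carrier R; r' \<in> carrier R; x \<in> carrier M\<rbrakk> \<Longrightarrow>
      (r \<oplus>\<^bsub>R\<^esub> r') \<odot>\<^bsub>M\<^esub> x = r \<odot>\<^bsub>M\<^esub> x \<oplus>\<^bsub>M\<^esub> r' \<odot>\<^bsub>M\<^esub> x"
    and lsmult_r_distr: "\<lbrakk>r \<in> carrier R; x \<in> carrier M; y \<in> carrier M\<rbrakk> \<Longrightarrow>
      r \<odot>\<^bsub>M\<^esub> (x \<oplus>\<^bsub>M\<^esub> y) = r \<odot>\<^bsub>M\<^esub> x \<oplus>\<^bsub>M\<^esub> r \<odot>\<^bsub>M\<^esub> y"
    and lsmult_assoc: "\<lbrakk>r \<in> carrier R; r' \<in> carrier R; x \<in> carrier M\<rbrakk> \<Longrightarrow>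
      (r \<otimes>\<^bsub>R\<^esub> r') \<odot>\<^bsub>M\<^esub> x = r \<odot>\<^bsub>M\<^esub> (r' \<odot>\<^bsub>M\<^esub> x)"
    and lsmult_one: "x \<in> carrier M \<Longrightarrow> \<one>\<^bsub>R\<^esub> \<odot>\<^bsub>M\<^esub> x = x"

locale right_module = S?: ring S + M?: abelian_group M for S (structure) and M (structure) +
  assumes rsmult_closed: "\<lbrakk>x \<in> carrier M; s \<in> carrier S\<rbrakk> \<Longrightarrow> x \<triangleleft>\<^bsub>M\<^esub> s \<in> carrier M"
    and rsmult_r_distr: "\<lbrakk>x \<in> carrier M; s \<in> carrier S; s' \<in> carrier S\<rbrakk> \<Longrightarrow>
      x \<triangleleft>\<^bsub>M\<^esub> (s \<oplus>\<^bsub>S\<^esub> s') = x \<triangleleft>\<^bsub>M\<^esub> s \<oplus>\<^bsub>M\<^esub> x \<triangleleft>\<^bsub>M\<^esub> s'"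
    and rsmult_l_distr: "\<lbrakk>x \<in> carrier M; y \<in> carrier M; s \<in> carrier S\<rbrakk> \<Longrightarrow>
      (x \<oplus>\<^bsub>M\<^esub> y) \<triangleleft>\<^bsub>M\<^esub> s = x \<triangleleft>\<^bsub>M\<^esub> s \<oplus>\<^bsub>M\<^esub> y \<triangleleft>\<^bsub>M\<^esub> s"
    and rsmult_assoc: "\<lbrakk>x \<in> carrier M; s \<in> carrier S; s' \<in> carrier S\<rbrakk> \<Longrightarrow>
      x \<triangleleft>\<^bsub>M\<^esub> (s \<otimes>\<^bsub>S\<^esub> s') = (x \<triangleleft>\<^bsub>M\<^esub> s) \<triangleleft>\<^bsub>M\<^esub> s'"
    and rsmult_one: "x \<in> carrier M \<Longrightarrow> x \<triangleleft>\<^bsub>M\<^esub> \<one>\<^bsub>S\<^esub> = x"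

locale bimodule = left_module R M + right_module S M
  for R (structure) and S (structure) and M (structure) +
  assumes smult_rsmult: "\<lbrakk>r \<in> carrier R; x \<in> carrier M; s \<in> carrier S\<rbrakk> \<Longrightarrow>
      (r \<odot>\<^bsub>M\<^esub> x) \<triangleleft>\<^bsub>M\<^esub> s = r \<odot>\<^bsub>M\<^esub> (x \<triangleleft>\<^bsub>M\<^esub> s)"

definition left_linear ::
    "('r, 'z) ring_scheme \<Rightarrow> ('r, 'm, 'x) module_scheme \<Rightarrow> ('r, 'n, 'y) module_scheme \<Rightarrow> ('m \<Rightarrow> 'n) \<Rightarrow> bool"
  where "left_linear R M N f \<longleftrightarrow>
    f \<in> hom (add_monoid M) (add_monoid N) \<and>
    (\<forall>r\<in>carrier R. \<forall>x\<in>carrier M. f (r \<odot>\<^bsub>M\<^esub> x) = r \<odot>\<^bsub>N\<^esub> f x)"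

definition right_linear ::
    "('s, 'z) ring_scheme \<Rightarrow> ('q, 'm, 's, 'x) bimodule_scheme \<Rightarrow> ('r, 'n, 's, 'y) bimodule_scheme \<Rightarrow> ('m \<Rightarrow> 'n) \<Rightarrow> bool"
  where "right_linear S M N f \<longleftrightarrow>
    f \<in> hom (add_monoid M) (add_monoid N) \<and>
    (\<forall>x\<in>carrier M. \<forall>s\<in>carrier S. f (x \<triangleleft>\<^bsub>M\<^esub> s) = f x \<triangleleft>\<^bsub>N\<^esub> s)"

definition bimodule_map ::
    "('r, 'z) ring_scheme \<Rightarrow> ('s, 'w) ring_scheme \<Rightarrow> ('r, 'm, 's, 'x) bimodule_scheme \<Rightarrow>
      ('r, 'n, 's, 'y) bimodule_scheme \<Rightarrow> ('m \<Rightarrow> 'n) \<Rightarrow> bool"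
  where "bimodule_map R S M N f \<longleftrightarrow> left_linear R M N f \<and> right_linear S M N f"

text \<open>A ring regarded as a bimodule over itself.\<close>

definition regular_bimodule :: "('r, 'z) ring_scheme \<Rightarrow> ('r, 'r, 'r) bimodule"
  where "regular_bimodule R =
    \<lparr>carrier = carrier R, monoid.mult = monoid.mult R, monoid.one = monoid.one R,
     ring.zero = ring.zero R, ring.add = ring.add R,
     smult = monoid.mult R, rsmult = monoid.mult R\<rparr>"

definition opposite_ring :: "'r ring \<Rightarrow> 'r ring"
  where "opposite_ring R = R\<lparr>monoid.mult := \<lambda>x y. y \<otimes>\<^bsub>R\<^esub> x\<rparr>"


section \<open>Tensor products\<close>

text \<open>For a right \<open>R\<close>-module \<open>M\<close> and a left \<open>R\<close>-module \<open>N\<close>, the tensor product over \<open>R\<close> is the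
  free abelian group on \<open>M \<times> N\<close> modulo the subgroup generated by the usual relations. Its
  elements are cosets.\<close>

type_synonym ('m, 'n) tensor = "(('m \<times> 'n) \<Rightarrow>\<^sub>0 int) set"

definition tensor_relations ::
    "('r, 'z) ring_scheme \<Rightarrow> ('l, 'm, 'r, 'x) bimodule_scheme \<Rightarrow> ('r, 'n, 'y) module_scheme \<Rightarrow>
      (('m \<times> 'n) \<Rightarrow>\<^sub>0 int) set"
  where "tensor_relations R M N =
      {frag_of (x \<oplus>\<^bsub>M\<^esub> x', y) - (frag_of (x, y) + frag_of (x', y)) | x x' y.
         x \<in> carrier M \<and> x' \<in> carrier M \<and> y \<in> carrier N}
    \<union> {frag_of (x, y \<oplus>\<^bsub>N\<^esub> y') - (frag_of (x, y) + frag_of (x, y')) | x y y'.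
         x \<in> carrier M \<and> y \<in> carrier N \<and> y' \<in> carrier N}
    \<union> {frag_of (x \<triangleleft>\<^bsub>M\<^esub> r, y) - frag_of (x, r \<odot>\<^bsub>N\<^esub> y) | x r y.
         x \<in> carrier M \<and> r \<in> carrier R \<and> y \<in> carrier N}"

definition tensor_subgroup ::
    "('r, 'z) ring_scheme \<Rightarrow> ('l, 'm, 'r, 'x) bimodule_scheme \<Rightarrow> ('r, 'n, 'y) module_scheme \<Rightarrow>
      (('m \<times> 'n) \<Rightarrow>\<^sub>0 int) set"
  where "tensor_subgroup R M N =
    generate (free_Abelian_group (carrier M \<times> carrier N)) (tensor_relations R M N)"

definition tensor_elem ::
    "('r, 'z) ring_scheme \<Rightarrow> ('l, 'm, 'r, 'x) bimodule_scheme \<Rightarrow> ('r, 'n, 'y) module_scheme \<Rightarrow>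
      'm \<Rightarrow> 'n \<Rightarrow> ('m, 'n) tensor"
  where "tensor_elem R M N x y =
    tensor_subgroup R M N #>\<^bsub>free_Abelian_group (carrier M \<times> carrier N)\<^esub> frag_of (x, y)"

text \<open>HOL-Algebra states abelian groups for ring records; the fields \<open>mult\<close> and \<open>one\<close> are not used.\<close>

definition tensor_group ::
    "('r, 'z) ring_scheme \<Rightarrow> ('l, 'm, 'r, 'x) bimodule_scheme \<Rightarrow> ('r, 'n, 'y) module_scheme \<Rightarrow>
      ('m, 'n) tensor ring"
  where "tensor_group R M N =
    (let G = free_Abelian_group (carrier M \<times> carrier N) Mod tensor_subgroup R M N
     in \<lparr>carrier = carrier G, monoid.mult = undefined, monoid.one = undefined,
         ring.zero = monoid.one G, ring.add = monoid.mult G\<rparr>)"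

text \<open>The map on the tensor product induced by a biadditive balanced map \<open>f\<close> into an abelian
  group \<open>G\<close>: a coset is sent to the common value at its representatives of the additive map that
  extends \<open>f\<close> to the free abelian group. For such \<open>f\<close> it sends the class of
  \<open>\<Sum> x\<^sub>i \<otimes> y\<^sub>i\<close> to \<open>\<Sum> f x\<^sub>i y\<^sub>i\<close>; if \<open>f\<close> is not balanced the
  value is unspecified.\<close>

definition tensor_lift :: "('g, 'z) ring_scheme \<Rightarrow> ('m \<Rightarrow> 'n \<Rightarrow> 'g) \<Rightarrow> ('m, 'n) tensor \<Rightarrow> 'g"
  where "tensor_lift G f X = the_elem
    ((\<lambda>u. \<Oplus>\<^bsub>G\<^esub>p\<in>Poly_Mapping.keys u. [Poly_Mapping.lookup u p] \<cdot>\<^bsub>G\<^esub> f (fst p) (snd p)) ` X)"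

text \<open>\<open>f \<otimes> g\<close> as a map into \<open>M' \<otimes>\<^sub>R N'\<close>.\<close>

definition tensor_map ::
    "('r, 'z) ring_scheme \<Rightarrow> ('l, 'p, 'r, 'x) bimodule_scheme \<Rightarrow> ('r, 'q, 'y) module_scheme \<Rightarrow>
      ('m \<Rightarrow> 'p) \<Rightarrow> ('n \<Rightarrow> 'q) \<Rightarrow> ('m, 'n) tensor \<Rightarrow> ('p, 'q) tensor"
  where "tensor_map R M' N' f g =
    tensor_lift (tensor_group R M' N') (\<lambda>x y. tensor_elem R M' N' (f x) (g y))"

text \<open>The left module \<open>M \<otimes>\<^sub>R N\<close> for a bimodule \<open>M\<close> and a left module \<open>N\<close>, and the
  bimodule \<open>M \<otimes>\<^sub>R N\<close> for two bimodules.\<close>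

definition tensor_module ::
    "('r, 'z) ring_scheme \<Rightarrow> ('l, 'm, 'r, 'x) bimodule_scheme \<Rightarrow> ('r, 'n, 'y) module_scheme \<Rightarrow>
      ('l, ('m, 'n) tensor) module"
  where "tensor_module R M N = ring.extend (tensor_group R M N)
    (module.fields (\<lambda>l. tensor_map R M N (\<lambda>x. l \<odot>\<^bsub>M\<^esub> x) (\<lambda>y. y)))"

definition tensor_bimodule ::
    "('r, 'z) ring_scheme \<Rightarrow> ('l, 'm, 'r, 'x) bimodule_scheme \<Rightarrow> ('r, 'n, 's, 'y) bimodule_scheme \<Rightarrow>
      ('l, ('m, 'n) tensor, 's) bimodule"
  where "tensor_bimodule R M N = module.extend (tensor_module R M N)
    (bimodule.fields (\<lambda>X s. tensor_map R M N (\<lambda>x. x) (\<lambda>y. y \<triangleleft>\<^bsub>N\<^esub> s) X))"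

text \<open>The canonical map \<open>(X \<otimes>\<^sub>R Y) \<otimes>\<^sub>S Z \<rightarrow> X \<otimes>\<^sub>R (Y \<otimes>\<^sub>S Z)\<close>.\<close>

definition tensor_assoc ::
    "('r, 'z) ring_scheme \<Rightarrow> ('s, 'w) ring_scheme \<Rightarrow> ('l, 'a, 'r, 'u) bimodule_scheme \<Rightarrow>
      ('r, 'b, 's, 'v) bimodule_scheme \<Rightarrow> ('s, 'c, 't) module_scheme \<Rightarrow>
      (('a, 'b) tensor, 'c) tensor \<Rightarrow> ('a, ('b, 'c) tensor) tensor"
  where "tensor_assoc R S X Y Z =
    (let YZ = tensor_module S Y Z; G = tensor_group R X YZ
     in tensor_lift G (\<lambda>w z. tensor_lift G (\<lambda>x y. tensor_elem R X YZ x (tensor_elem S Y Z y z)) w))"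


section \<open>Corings and comodules\<close>

record ('a, 'c) coring = "('a, 'c, 'a) bimodule" +
  comult :: "'c \<Rightarrow> ('c, 'c) tensor"
  counit :: "'c \<Rightarrow> 'a"

locale coring = bimodule A A C for A (structure) and C (structure) +
  assumes comult_map: "bimodule_map A A C (tensor_bimodule A C C) (comult C)"
    and counit_map: "bimodule_map A A C (regular_bimodule A) (counit C)"
    and coassoc: "c \<in> carrier C \<Longrightarrow>
      tensor_assoc A A C C C (tensor_map A (tensor_bimodule A C C) C (comult C) (\<lambda>d. d) (comult C c))
        = tensor_map A C (tensor_module A C C) (\<lambda>d. d) (comult C) (comult C c)"
    and counit_left: "c \<in> carrier C \<Longrightarrow>
      tensor_lift C (\<lambda>d d'. counit C d \<odot>\<^bsub>C\<^esub> d') (comult C c) = c"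
    and counit_right: "c \<in> carrier C \<Longrightarrow>
      tensor_lift C (\<lambda>d d'. d \<triangleleft>\<^bsub>C\<^esub> counit C d') (comult C c) = c"

record ('a, 'c, 'm) comodule = "('a, 'm) module" +
  coact :: "'m \<Rightarrow> ('c, 'm) tensor"

locale left_comodule = C?: coring A C + left_module A M
  for A (structure) and C (structure) and M (structure) +
  assumes coact_linear: "left_linear A M (tensor_module A C M) (coact M)"
    and coact_coassoc: "m \<in> carrier M \<Longrightarrow>
      tensor_assoc A A C C M (tensor_map A (tensor_bimodule A C C) M (comult C) (\<lambda>x. x) (coact M m))
        = tensor_map A C (tensor_module A C M) (\<lambda>d. d) (coact M) (coact M m)"
    and coact_counit: "m \<in> carrier M \<Longrightarrow>
      tensor_lift M (\<lambda>d x. counit C d \<odot>\<^bsub>M\<^esub> x) (coact M m) = m"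

text \<open>The coring as a left comodule over itself.\<close>

definition coring_comodule :: "('a, 'c, 'x) coring_scheme \<Rightarrow> ('a, 'c, 'c) comodule"
  where "coring_comodule C =
    \<lparr>carrier = carrier C, monoid.mult = monoid.mult C, monoid.one = monoid.one C,
     ring.zero = ring.zero C, ring.add = ring.add C,
     smult = smult C, coact = comult C\<rparr>"

definition colinear ::
    "('a, 'z) ring_scheme \<Rightarrow> ('a, 'c, 'w) coring_scheme \<Rightarrow> ('a, 'c, 'm, 'x) comodule_scheme \<Rightarrow>
      ('a, 'c, 'n, 'y) comodule_scheme \<Rightarrow> ('m \<Rightarrow> 'n) \<Rightarrow> bool"
  where "colinear A C M N f \<longleftrightarrow> left_linear A M N f \<and>
    (\<forall>x\<in>carrier M. coact N (f x) = tensor_map A C N (\<lambda>d. d) f (coact M x))"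

text \<open>Maps that are elements of a Hom set are \<open>undefined\<close> outside the carrier, so that
  equality of such maps is equality on the carrier.\<close>

definition linear_Hom ::
    "('r, 'z) ring_scheme \<Rightarrow> ('r, 'm, 'x) module_scheme \<Rightarrow> ('r, 'n, 'y) module_scheme \<Rightarrow> ('m \<Rightarrow> 'n) set"
  where "linear_Hom R M N = {f \<in> extensional (carrier M). left_linear R M N f}"

definition colinear_Hom ::
    "('a, 'z) ring_scheme \<Rightarrow> ('a, 'c, 'w) coring_scheme \<Rightarrow> ('a, 'c, 'm, 'x) comodule_scheme \<Rightarrow>
      ('a, 'c, 'n, 'y) comodule_scheme \<Rightarrow> ('m \<Rightarrow> 'n) set"
  where "colinear_Hom A C M N = {f \<in> extensional (carrier M). colinear A C M N f}"

definition pointwise_add ::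
    "('m, 'x) ring_scheme \<Rightarrow> ('n, 'y) ring_scheme \<Rightarrow> ('m \<Rightarrow> 'n) \<Rightarrow> ('m \<Rightarrow> 'n) \<Rightarrow> 'm \<Rightarrow> 'n"
  where "pointwise_add M N f g = (\<lambda>x\<in>carrier M. f x \<oplus>\<^bsub>N\<^esub> g x)"

definition pointwise_zero :: "('m, 'x) ring_scheme \<Rightarrow> ('n, 'y) ring_scheme \<Rightarrow> 'm \<Rightarrow> 'n"
  where "pointwise_zero M N = (\<lambda>x\<in>carrier M. \<zero>\<^bsub>N\<^esub>)"


section \<open>Morita contexts\<close>

locale morita_context = bimodule R S P + Q: bimodule S R Q
  for R (structure) and S (structure) and P (structure) and Q (structure) and \<tau> and \<mu> +
  assumes \<tau>_map: "bimodule_map R R (tensor_bimodule S P Q) (regular_bimodule R) \<tau>"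
    and \<mu>_map: "bimodule_map S S (tensor_bimodule R Q P) (regular_bimodule S) \<mu>"
    and \<tau>_\<mu>: "\<lbrakk>p \<in> carrier P; p' \<in> carrier P; q \<in> carrier Q\<rbrakk> \<Longrightarrow>
      \<tau> (tensor_elem S P Q p q) \<odot>\<^bsub>P\<^esub> p' = p \<triangleleft>\<^bsub>P\<^esub> \<mu> (tensor_elem R Q P q p')"
    and \<mu>_\<tau>: "\<lbrakk>p \<in> carrier P; q \<in> carrier Q; q' \<in> carrier Q\<rbrakk> \<Longrightarrow>
      \<mu> (tensor_elem R Q P q p) \<odot>\<^bsub>Q\<^esub> q' = q \<triangleleft>\<^bsub>Q\<^esub> \<tau> (tensor_elem S P Q p q')"


section \<open>The data attached to a comodule\<close>

text \<open>\<open>contract C \<phi> (\<Sum> c\<^sub>i \<otimes> x\<^sub>i) = \<Sum> c\<^sub>i \<phi>(x\<^sub>i)\<close>; at a coaction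
  \<open>coact M m\<close> this is the Sweedler expression \<open>m\<^bsub>[-1]\<^esub> \<phi>(m\<^bsub>[0]\<^esub>)\<close>, and at
  \<open>comult C c\<close> it is \<open>c\<^bsub>(1)\<^esub> \<phi>(c\<^bsub>(2)\<^esub>)\<close>.\<close>

definition contract :: "('a, 'c, 'w) coring_scheme \<Rightarrow> ('m \<Rightarrow> 'a) \<Rightarrow> ('c, 'm) tensor \<Rightarrow> 'c"
  where "contract C \<phi> = tensor_lift C (\<lambda>c x. c \<triangleleft>\<^bsub>C\<^esub> \<phi> x)"

text \<open>The ring \<open>{}\<^sup>*C\<close>.\<close>

definition left_dual_ring :: "('a, 'z) ring_scheme \<Rightarrow> ('a, 'c, 'w) coring_scheme \<Rightarrow> ('c \<Rightarrow> 'a) ring"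
  where "left_dual_ring A C =
    \<lparr>carrier = linear_Hom A C (regular_bimodule A),
     monoid.mult = (\<lambda>f g. \<lambda>c\<in>carrier C. g (contract C f (comult C c))),
     monoid.one = restrict (counit C) (carrier C),
     ring.zero = pointwise_zero C A,
     ring.add = pointwise_add C A\<rparr>"

definition comodule_End ::
    "('a, 'z) ring_scheme \<Rightarrow> ('a, 'c, 'w) coring_scheme \<Rightarrow> ('a, 'c, 'm, 'x) comodule_scheme \<Rightarrow> ('m \<Rightarrow> 'm) ring"
  where "comodule_End A C M =
    \<lparr>carrier = colinear_Hom A C M M,
     monoid.mult = compose (carrier M),
     monoid.one = (\<lambda>m\<in>carrier M. m),
     ring.zero = pointwise_zero M M,
     ring.add = pointwise_add M M\<rparr>"

definition T_ring ::
    "('a, 'z) ring_scheme \<Rightarrow> ('a, 'c, 'w) coring_scheme \<Rightarrow> ('a, 'c, 'm, 'x) comodule_scheme \<Rightarrow> ('m \<Rightarrow> 'm) ring"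
  where "T_ring A C M = opposite_ring (comodule_End A C M)"

text \<open>\<open>{}\<^sup>*M\<close> with its left \<open>T\<close>-action and right \<open>{}\<^sup>*C\<close>-action.\<close>

definition dual_bimodule ::
    "('a, 'z) ring_scheme \<Rightarrow> ('a, 'c, 'w) coring_scheme \<Rightarrow> ('a, 'c, 'm, 'x) comodule_scheme \<Rightarrow>
      ('m \<Rightarrow> 'm, 'm \<Rightarrow> 'a, 'c \<Rightarrow> 'a) bimodule"
  where "dual_bimodule A C M =
    \<lparr>carrier = linear_Hom A M (regular_bimodule A), monoid.mult = undefined, monoid.one = undefined,
     ring.zero = pointwise_zero M A,
     ring.add = pointwise_add M A,
     smult = (\<lambda>t \<phi>. compose (carrier M) \<phi> t),
     rsmult = (\<lambda>\<phi> f. \<lambda>m\<in>carrier M. f (contract C \<phi> (coact M m)))\<rparr>"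

text \<open>\<open>Q\<close> with its left \<open>{}\<^sup>*C\<close>-action and right \<open>T\<close>-action.\<close>

definition Q_bimodule ::
    "('a, 'z) ring_scheme \<Rightarrow> ('a, 'c, 'w) coring_scheme \<Rightarrow> ('a, 'c, 'm, 'x) comodule_scheme \<Rightarrow>
      ('c \<Rightarrow> 'a, 'c \<Rightarrow> 'm, 'm \<Rightarrow> 'm) bimodule"
  where "Q_bimodule A C M =
    \<lparr>carrier = colinear_Hom A C (coring_comodule C) M, monoid.mult = undefined, monoid.one = undefined,
     ring.zero = pointwise_zero C M,
     ring.add = pointwise_add C M,
     smult = (\<lambda>f q. \<lambda>c\<in>carrier C. q (contract C f (comult C c))),
     rsmult = (\<lambda>q t. compose (carrier C) t q)\<rparr>"

definition tau_map ::
    "('a, 'z) ring_scheme \<Rightarrow> ('a, 'c, 'w) coring_scheme \<Rightarrow> ('a, 'c, 'm, 'x) comodule_scheme \<Rightarrow>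
      ('m \<Rightarrow> 'a, 'c \<Rightarrow> 'm) tensor \<Rightarrow> 'm \<Rightarrow> 'm"
  where "tau_map A C M = tensor_lift (T_ring A C M)
    (\<lambda>\<phi> q. \<lambda>m\<in>carrier M. q (contract C \<phi> (coact M m)))"

definition mu_map ::
    "('a, 'z) ring_scheme \<Rightarrow> ('a, 'c, 'w) coring_scheme \<Rightarrow> ('a, 'c, 'm, 'x) comodule_scheme \<Rightarrow>
      ('c \<Rightarrow> 'm, 'm \<Rightarrow> 'a) tensor \<Rightarrow> 'c \<Rightarrow> 'a"
  where "mu_map A C M = tensor_lift (left_dual_ring A C) (\<lambda>q \<phi>. compose (carrier C) \<phi> q)"

end

theory Submission
  imports Defs
begin

text \<open>
  For a left comodule \<open>N\<close> and a left linear functional \<open>\<phi>\<close> on \<open>N\<close>, let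
  \<open>F\<^sub>\<phi>(n) = n\<^bsub>[-1]\<^esub> \<phi>(n\<^bsub>[0]\<^esub>)\<close>, that is,
  \<open>contract C \<phi> (coact N n)\<close>. Coassociativity of the coaction and right linearity of
  \<open>\<Delta>\<close> make \<open>F\<^sub>\<phi>\<close> a colinear map \<open>N \<rightarrow> C\<close>
  (\<open>contract_colinear\<close>), and the counit gives \<open>\<epsilon> \<circ> F\<^sub>\<phi> = \<phi>\<close>
  (\<open>counit_contract\<close>). If \<open>t : N \<rightarrow> K\<close> is colinear and \<open>\<phi>\<close> is a functional on
  \<open>K\<close>, then \<open>F\<^bsub>\<phi> \<circ> t\<^esub> = F\<^sub>\<phi> \<circ> t\<close> (\<open>contract_comp\<close>).

  In this notation every operation of the Morita context is a composition:
  \<open>f # g = g \<circ> F\<^sub>f\<close>, \<open>\<phi> \<cdot> f = f \<circ> F\<^sub>\<phi>\<close>,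
  \<open>f \<cdot> q = q \<circ> F\<^sub>f\<close>, \<open>\<tau>(\<phi> \<otimes> q) = q \<circ> F\<^sub>\<phi>\<close> and
  \<open>\<mu>(q \<otimes> \<phi>) = \<phi> \<circ> q\<close>. The map \<open>F\<^bsub>f \<circ> F\<^sub>\<phi>\<^esub>\<close> is
  \<open>F\<^sub>f \<circ> F\<^sub>\<phi>\<close>, by the rule for \<open>F\<^bsub>\<phi> \<circ> t\<^esub>\<close> with
  \<open>t = F\<^sub>\<phi>\<close>. All associativity, balancing and compatibility laws then reduce to
  associativity of composition, the unit laws to the counit axioms, and the additive laws to additivity of the maps involved. For
  instance, both sides of \<open>\<tau>(\<phi> \<otimes> q) \<cdot> \<psi> = \<phi> \<cdot> \<mu>(q \<otimes> \<psi>)\<close> are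
  \<open>\<psi> \<circ> q \<circ> F\<^sub>\<phi>\<close>.

  These computations rest on two facts about the tensor product as a quotient of a free abelian
  group: a balanced map induces an additive map with the expected values on elementary tensors
  (\<open>tensor_lift_elem\<close>, \<open>tensor_lift_hom\<close>), and the elementary tensors generate
  additively (\<open>tensor_induct\<close>), so that two additive maps that agree on them are equal.
\<close>


section \<open>Linear maps\<close>

lemma left_linearD:
  assumes "left_linear R M N f"
  shows "f \<in> hom (add_monoid M) (add_monoid N)"
    and "x \<in> carrier M \<Longrightarrow> f x \<in> carrier N"
    and "\<lbrakk>x \<in> carrier M; y \<in> carrier M\<rbrakk> \<Longrightarrow> f (x \<oplus>\<^bsub>M\<^esub> y) = f x \<oplus>\<^bsub>N\<^esub> f y"
    and "\<lbrakk>r \<in> carrier R; x \<in> carrier M\<rbrakk> \<Longrightarrow> f (r \<odot>\<^bsub>M\<^esub> x) = r \<odot>\<^bsub>N\<^esub> f x"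
  using assms by (auto simp: left_linear_def hom_def)

lemma right_linearD:
  assumes "right_linear S M N f"
  shows "f \<in> hom (add_monoid M) (add_monoid N)"
    and "x \<in> carrier M \<Longrightarrow> f x \<in> carrier N"
    and "\<lbrakk>x \<in> carrier M; y \<in> carrier M\<rbrakk> \<Longrightarrow> f (x \<oplus>\<^bsub>M\<^esub> y) = f x \<oplus>\<^bsub>N\<^esub> f y"
    and "\<lbrakk>x \<in> carrier M; s \<in> carrier S\<rbrakk> \<Longrightarrow> f (x \<triangleleft>\<^bsub>M\<^esub> s) = f x \<triangleleft>\<^bsub>N\<^esub> s"
  using assms by (auto simp: right_linear_def hom_def)

lemma left_linearI:
  assumes "\<And>x. x \<in> carrier M \<Longrightarrow> f x \<in> carrier N"
    and "\<And>x y. \<lbrakk>x \<in> carrier M; y \<in> carrier M\<rbrakk> \<Longrightarrow> f (x \<oplus>\<^bsub>M\<^esub> y) = f x \<oplus>\<^bsub>N\<^esub> f y"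
    and "\<And>r x. \<lbrakk>r \<in> carrier R; x \<in> carrier M\<rbrakk> \<Longrightarrow> f (r \<odot>\<^bsub>M\<^esub> x) = r \<odot>\<^bsub>N\<^esub> f x"
  shows "left_linear R M N f"
  using assms by (auto simp: left_linear_def hom_def)

lemma right_linearI:
  assumes "\<And>x. x \<in> carrier M \<Longrightarrow> f x \<in> carrier N"
    and "\<And>x y. \<lbrakk>x \<in> carrier M; y \<in> carrier M\<rbrakk> \<Longrightarrow> f (x \<oplus>\<^bsub>M\<^esub> y) = f x \<oplus>\<^bsub>N\<^esub> f y"
    and "\<And>x s. \<lbrakk>x \<in> carrier M; s \<in> carrier S\<rbrakk> \<Longrightarrow> f (x \<triangleleft>\<^bsub>M\<^esub> s) = f x \<triangleleft>\<^bsub>N\<^esub> s"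
  shows "right_linear S M N f"
  using assms by (auto simp: right_linear_def hom_def)

lemma left_linear_id: "left_linear R M M (\<lambda>x. x)"
  by (rule left_linearI) simp_all

lemma right_linear_id: "right_linear S M M (\<lambda>x. x)"
  by (rule right_linearI) simp_all

lemma left_linear_comp:
  assumes "left_linear R M N f" "left_linear R N K g"
  shows "left_linear R M K (\<lambda>x. g (f x))"
  by (rule left_linearI) (simp_all add: left_linearD[OF assms(1)] left_linearD[OF assms(2)])

lemma add_homD:
  assumes "h \<in> hom (add_monoid G) (add_monoid K)"
  shows "x \<in> carrier G \<Longrightarrow> h x \<in> carrier K"
    and "\<lbrakk>x \<in> carrier G; y \<in> carrier G\<rbrakk> \<Longrightarrow> h (x \<oplus>\<^bsub>G\<^esub> y) = h x \<oplus>\<^bsub>K\<^esub> h y"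
  using assms by (auto simp: hom_def)

lemma right_linear_lsmult:
  assumes "bimodule L R M" "l \<in> carrier L"
  shows "right_linear R M M (\<lambda>x. l \<odot>\<^bsub>M\<^esub> x)"
proof -
  interpret bimodule L R M by (rule assms)
  show ?thesis
    by (rule right_linearI) (simp_all add: assms(2) lsmult_closed lsmult_r_distr smult_rsmult)
qed

lemma left_linear_rsmult:
  assumes "bimodule R S N" "s \<in> carrier S"
  shows "left_linear R N N (\<lambda>y. y \<triangleleft>\<^bsub>N\<^esub> s)"
proof -
  interpret bimodule R S N by (rule assms)
  show ?thesis
    by (rule left_linearI) (simp_all add: assms(2) rsmult_closed rsmult_l_distr smult_rsmult)
qed

lemma abelian_group_cong:
  assumes "abelian_group G" "carrier K = carrier G" "ring.add K = ring.add G" "ring.zero K = ring.zero G"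
  shows "abelian_group K"
proof -
  interpret G: abelian_group G by (rule assms)
  show ?thesis
  proof (rule abelian_groupI)
    show "\<exists>y\<in>carrier K. y \<oplus>\<^bsub>K\<^esub> x = \<zero>\<^bsub>K\<^esub>" if "x \<in> carrier K" for x
      using that G.l_neg by (auto simp: assms)
  qed (simp_all add: assms G.a_ac)
qed

lemma left_linear_zero_minus:
  assumes "abelian_group M" "abelian_group N" "left_linear R M N f"
  shows left_linear_zero: "f \<zero>\<^bsub>M\<^esub> = \<zero>\<^bsub>N\<^esub>"
    and left_linear_minus: "x \<in> carrier M \<Longrightarrow> f (\<ominus>\<^bsub>M\<^esub> x) = \<ominus>\<^bsub>N\<^esub> f x"
proof -
  interpret abelian_group_hom M N f
    using assms by (intro abelian_group_homI) (auto simp: group_hom_def group_hom_axioms_def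
        abelian_group.a_group left_linear_def)
  show "f \<zero>\<^bsub>M\<^esub> = \<zero>\<^bsub>N\<^esub>" by (rule hom_zero)
  show "x \<in> carrier M \<Longrightarrow> f (\<ominus>\<^bsub>M\<^esub> x) = \<ominus>\<^bsub>N\<^esub> f x" by (rule hom_a_inv)
qed

context left_module
begin

lemma lsmult_zero: "r \<in> carrier R \<Longrightarrow> r \<odot>\<^bsub>M\<^esub> \<zero>\<^bsub>M\<^esub> = \<zero>\<^bsub>M\<^esub>"
  using lsmult_r_distr[of r "\<zero>\<^bsub>M\<^esub>" "\<zero>\<^bsub>M\<^esub>"] lsmult_closed[of r "\<zero>\<^bsub>M\<^esub>"]
  by (simp add: M.add.l_cancel_one')

lemma lsmult_minus:
  assumes "r \<in> carrier R" "x \<in> carrier M"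
  shows "r \<odot>\<^bsub>M\<^esub> (\<ominus>\<^bsub>M\<^esub> x) = \<ominus>\<^bsub>M\<^esub> (r \<odot>\<^bsub>M\<^esub> x)"
  using lsmult_r_distr[of r "\<ominus>\<^bsub>M\<^esub> x" x] assms
  by (simp add: M.l_neg lsmult_zero lsmult_closed M.minus_equality)

end

lemma left_linear_add:
  assumes "left_module R N" "left_linear R M N f" "left_linear R M N g"
  shows "left_linear R M N (\<lambda>x. f x \<oplus>\<^bsub>N\<^esub> g x)"
proof -
  interpret N: left_module R N by (rule assms)
  show ?thesis
    by (rule left_linearI)
      (simp_all add: left_linearD[OF assms(2)] left_linearD[OF assms(3)] N.lsmult_r_distr N.M.a_ac)
qed

lemma left_linear_const_zero:
  assumes "left_module R N"
  shows "left_linear R M N (\<lambda>x. \<zero>\<^bsub>N\<^esub>)"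
proof -
  interpret N: left_module R N by (rule assms)
  show ?thesis
    by (rule left_linearI) (simp_all add: N.lsmult_zero)
qed

lemma left_linear_uminus:
  assumes "left_module R N" "left_linear R M N f"
  shows "left_linear R M N (\<lambda>x. \<ominus>\<^bsub>N\<^esub> f x)"
proof -
  interpret N: left_module R N by (rule assms)
  show ?thesis
    by (rule left_linearI)
      (simp_all add: left_linearD[OF assms(2)] N.lsmult_minus N.M.minus_add N.M.a_comm)
qed

lemma left_linear_cong:
  assumes "left_linear R M N f" "\<And>x. x \<in> carrier M \<Longrightarrow> f x = g x" "left_module R M"
  shows "left_linear R M N g"
proof -
  interpret M: left_module R M by (rule assms)
  show ?thesis
    by (rule left_linearI) (simp_all add: left_linearD[OF assms(1)] M.lsmult_closed assms(2)[symmetric])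
qed

lemma regular_bimodule_simps [simp]:
  "carrier (regular_bimodule R) = carrier R"
  "ring.add (regular_bimodule R) = ring.add R"
  "ring.zero (regular_bimodule R) = ring.zero R"
  "smult (regular_bimodule R) = monoid.mult R"
  "rsmult (regular_bimodule R) = monoid.mult R"
  by (simp_all add: regular_bimodule_def)

lemma left_module_regular:
  assumes "ring R"
  shows "left_module R (regular_bimodule R)"
proof -
  interpret ring R by (rule assms)
  show ?thesis
    by (intro left_module.intro left_module_axioms.intro assms abelian_group_cong[OF abelian_group_axioms])
      (simp_all add: l_distr r_distr m_assoc)
qed


section \<open>The universal property of the tensor product\<close>

text \<open>Biadditive maps \<open>f : M \<times> N \<rightarrow> G\<close> with \<open>f (x r) y = f x (r y)\<close>, for a
  right \<open>R\<close>-module \<open>M\<close>, a left \<open>R\<close>-module \<open>N\<close> and an abelian group \<open>G\<close>.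
  Only values on the carriers are constrained.\<close>

definition balanced ::
    "('r, 'z) ring_scheme \<Rightarrow> ('l, 'm, 'r, 'x) bimodule_scheme \<Rightarrow> ('r, 'n, 'y) module_scheme \<Rightarrow>
      ('g, 'w) ring_scheme \<Rightarrow> ('m \<Rightarrow> 'n \<Rightarrow> 'g) \<Rightarrow> bool"
  where "balanced R M N G f \<longleftrightarrow>
    (\<forall>x\<in>carrier M. \<forall>y\<in>carrier N. f x y \<in> carrier G) \<and>
    (\<forall>x\<in>carrier M. \<forall>x'\<in>carrier M. \<forall>y\<in>carrier N. f (x \<oplus>\<^bsub>M\<^esub> x') y = f x y \<oplus>\<^bsub>G\<^esub> f x' y) \<and>
    (\<forall>x\<in>carrier M. \<forall>y\<in>carrier N. \<forall>y'\<in>carrier N. f x (y \<oplus>\<^bsub>N\<^esub> y') = f x y \<oplus>\<^bsub>G\<^esub> f x y') \<and>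
    (\<forall>x\<in>carrier M. \<forall>r\<in>carrier R. \<forall>y\<in>carrier N. f (x \<triangleleft>\<^bsub>M\<^esub> r) y = f x (r \<odot>\<^bsub>N\<^esub> y))"

lemma balancedI:
  assumes "\<And>x y. \<lbrakk>x \<in> carrier M; y \<in> carrier N\<rbrakk> \<Longrightarrow> f x y \<in> carrier G"
    and "\<And>x x' y. \<lbrakk>x \<in> carrier M; x' \<in> carrier M; y \<in> carrier N\<rbrakk> \<Longrightarrow> f (x \<oplus>\<^bsub>M\<^esub> x') y = f x y \<oplus>\<^bsub>G\<^esub> f x' y"
    and "\<And>x y y'. \<lbrakk>x \<in> carrier M; y \<in> carrier N; y' \<in> carrier N\<rbrakk> \<Longrightarrow> f x (y \<oplus>\<^bsub>N\<^esub> y') = f x y \<oplus>\<^bsub>G\<^esub> f x y'"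
    and "\<And>x r y. \<lbrakk>x \<in> carrier M; r \<in> carrier R; y \<in> carrier N\<rbrakk> \<Longrightarrow> f (x \<triangleleft>\<^bsub>M\<^esub> r) y = f x (r \<odot>\<^bsub>N\<^esub> y)"
  shows "balanced R M N G f"
  using assms by (simp add: balanced_def)

text \<open>The additive extension of a map on generators to the free abelian group, in the form in which
  it occurs inside \<open>tensor_lift\<close>.\<close>

lemma (in abelian_group) free_extension:
  fixes f :: "'p \<Rightarrow> 'a"
  assumes f: "f \<in> S \<rightarrow> carrier G"
  defines "E \<equiv> \<lambda>u. \<Oplus>p\<in>Poly_Mapping.keys u. [Poly_Mapping.lookup u p] \<cdot> f p"
  shows "E \<in> hom (free_Abelian_group S) (add_monoid G)"
    and "p \<in> S \<Longrightarrow> E (frag_of p) = f p"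
proof -
  \<comment> \<open>The sum may run over any finite set of generators that contains the support.\<close>
  have ext: "E u = (\<Oplus>p\<in>K. [Poly_Mapping.lookup u p] \<cdot> f p)"
    if "finite K" "Poly_Mapping.keys u \<subseteq> K" "K \<subseteq> S" for u K
    unfolding E_def
    by (rule add.finprod_mono_neutral_cong_left)
      (use that f in \<open>auto simp: in_keys_iff add_pow_def[of _ "0::int"] intro!: add.int_pow_closed\<close>)
  show "E \<in> hom (free_Abelian_group S) (add_monoid G)"
  proof (rule homI)
    fix u assume "u \<in> carrier (free_Abelian_group S)"
    then show "E u \<in> carrier (add_monoid G)"
      unfolding E_def using f by (auto intro!: finsum_closed)
  next
    fix u v
    assume u: "u \<in> carrier (free_Abelian_group S)" and v: "v \<in> carrier (free_Abelian_group S)"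
    let ?K = "Poly_Mapping.keys u \<union> Poly_Mapping.keys v"
    have K: "finite ?K" "?K \<subseteq> S" using u v by auto
    have fK: "p \<in> ?K \<Longrightarrow> f p \<in> carrier G" for p using K f by auto
    have "E (u + v) = (\<Oplus>p\<in>?K. [Poly_Mapping.lookup (u + v) p] \<cdot> f p)"
      by (rule ext) (use K in \<open>auto dest: subsetD[OF keys_add]\<close>)
    also have "\<dots> = (\<Oplus>p\<in>?K. [Poly_Mapping.lookup u p] \<cdot> f p \<oplus> [Poly_Mapping.lookup v p] \<cdot> f p)"
      by (rule finsum_cong') (use fK in \<open>auto simp: Poly_Mapping.lookup_add add.int_pow_mult\<close>)
    also have "\<dots> = (\<Oplus>p\<in>?K. [Poly_Mapping.lookup u p] \<cdot> f p) \<oplus> (\<Oplus>p\<in>?K. [Poly_Mapping.lookup v p] \<cdot> f p)"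
      by (rule finsum_addf) (use fK in auto)
    also have "\<dots> = E u \<oplus> E v"
      using ext[of ?K u] ext[of ?K v] K by simp
    finally show "E (u \<otimes>\<^bsub>free_Abelian_group S\<^esub> v) = E u \<otimes>\<^bsub>add_monoid G\<^esub> E v"
      by simp
  qed
  show "E (frag_of p) = f p" if "p \<in> S"
  proof -
    have fp: "f p \<in> carrier G"
      using that f by auto
    then have "[(1::int)] \<cdot> f p = f p"
      by (rule add.int_pow_1)
    with fp show ?thesis
      using that by (subst ext[of "{p}"]) (auto simp: finsum_insert)
  qed
qed

text \<open>The hypotheses under which \<open>M \<otimes>\<^sub>R N\<close> makes sense. Closure of both actions is what puts
  the defining relations inside the free abelian group on \<open>M \<times> N\<close>.\<close>

locale tensor_factors =
  fixes R :: "('r, 'z) ring_scheme"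
    and M :: "('l, 'm, 'r, 'x) bimodule_scheme"
    and N :: "('r, 'n, 'y) module_scheme"
  assumes right_factor: "right_module R M" and left_factor: "left_module R N"
begin

interpretation M: right_module R M by (rule right_factor)
interpretation N: left_module R N by (rule left_factor)

abbreviation (input) "F \<equiv> free_Abelian_group (carrier M \<times> carrier N)"
abbreviation (input) "H \<equiv> tensor_subgroup R M N"
abbreviation (input) "MN \<equiv> tensor_group R M N"
abbreviation (input) "tens \<equiv> tensor_elem R M N"

lemma relations_subset: "tensor_relations R M N \<subseteq> carrier F"
  unfolding tensor_relations_def
  by (auto simp: M.rsmult_closed N.lsmult_closed
      dest!: subsetD[OF keys_diff] subsetD[OF keys_add])

lemma subgroup_tensor: "subgroup H F"
  unfolding tensor_subgroup_def
  by (rule group.generate_is_subgroup[OF group_free_Abelian_group relations_subset])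

lemma normal_tensor: "H \<lhd> F"
  using subgroup_tensor comm_group.subgroup_imp_normal[OF abelian_free_Abelian_group] by blast

lemma add_monoid_tensor_group: "add_monoid MN = F Mod H"
  by (simp add: tensor_group_def Let_def FactGroup_def)

lemma abelian_group_tensor: "abelian_group MN"
  by (rule comm_group_abelian_groupI, unfold add_monoid_tensor_group)
    (rule comm_group.abelian_FactGroup[OF abelian_free_Abelian_group subgroup_tensor])

lemma carrier_tensor_group: "carrier MN = (\<lambda>u. H #>\<^bsub>F\<^esub> u) ` carrier F"
  by (simp add: tensor_group_def Let_def carrier_FactGroup)

lemma coset_add:
  assumes "u \<in> carrier F" "v \<in> carrier F"
  shows "(H #>\<^bsub>F\<^esub> u) \<oplus>\<^bsub>MN\<^esub> (H #>\<^bsub>F\<^esub> v) = H #>\<^bsub>F\<^esub> (u + v)"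
  using normal.rcos_sum[OF normal_tensor assms] by (simp add: tensor_group_def Let_def)

lemma coset_zero: "H #>\<^bsub>F\<^esub> 0 = \<zero>\<^bsub>MN\<^esub>"
  using group.coset_mult_one[OF group_free_Abelian_group subgroup.subset[OF subgroup_tensor]]
  by (simp add: tensor_group_def Let_def)

lemma coset_eqI:
  assumes "u - v \<in> tensor_relations R M N" "u \<in> carrier F" "v \<in> carrier F"
  shows "H #>\<^bsub>F\<^esub> u = H #>\<^bsub>F\<^esub> v"
proof -
  have "u - v \<in> H"
    unfolding tensor_subgroup_def using assms(1) by (rule generate.incl)
  then have "u \<in> H #>\<^bsub>F\<^esub> v"
    by (force simp: r_coset_def)
  then show ?thesis
    using group.repr_independence[OF group_free_Abelian_group _ assms(3) subgroup_tensor] by simp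
qed

lemma elem_closed: "\<lbrakk>x \<in> carrier M; y \<in> carrier N\<rbrakk> \<Longrightarrow> tens x y \<in> carrier MN"
  by (auto simp: carrier_tensor_group tensor_elem_def)

lemma elem_add_left:
  assumes "x \<in> carrier M" "x' \<in> carrier M" "y \<in> carrier N"
  shows "tens (x \<oplus>\<^bsub>M\<^esub> x') y = tens x y \<oplus>\<^bsub>MN\<^esub> tens x' y"
proof -
  have "tens (x \<oplus>\<^bsub>M\<^esub> x') y = H #>\<^bsub>F\<^esub> (frag_of (x, y) + frag_of (x', y))"
    unfolding tensor_elem_def
    by (rule coset_eqI) (use assms in \<open>auto simp: tensor_relations_def dest!: subsetD[OF keys_add]\<close>)
  then show ?thesis
    using assms by (simp add: coset_add tensor_elem_def)
qed

lemma elem_add_right: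
  assumes "x \<in> carrier M" "y \<in> carrier N" "y' \<in> carrier N"
  shows "tens x (y \<oplus>\<^bsub>N\<^esub> y') = tens x y \<oplus>\<^bsub>MN\<^esub> tens x y'"
proof -
  have "tens x (y \<oplus>\<^bsub>N\<^esub> y') = H #>\<^bsub>F\<^esub> (frag_of (x, y) + frag_of (x, y'))"
    unfolding tensor_elem_def
    by (rule coset_eqI) (use assms in \<open>auto simp: tensor_relations_def dest!: subsetD[OF keys_add]\<close>)
  then show ?thesis
    using assms by (simp add: coset_add tensor_elem_def)
qed

lemma elem_balanced:
  assumes "x \<in> carrier M" "r \<in> carrier R" "y \<in> carrier N"
  shows "tens (x \<triangleleft>\<^bsub>M\<^esub> r) y = tens x (r \<odot>\<^bsub>N\<^esub> y)"
  unfolding tensor_elem_def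
  by (rule coset_eqI)
    (use assms in \<open>auto simp: tensor_relations_def M.rsmult_closed N.lsmult_closed\<close>)

lemma elem_zero_left:
  assumes "y \<in> carrier N"
  shows "tens \<zero>\<^bsub>M\<^esub> y = \<zero>\<^bsub>MN\<^esub>"
proof -
  interpret MN: abelian_group MN by (rule abelian_group_tensor)
  have "tens \<zero>\<^bsub>M\<^esub> y \<oplus>\<^bsub>MN\<^esub> tens \<zero>\<^bsub>M\<^esub> y = tens \<zero>\<^bsub>M\<^esub> y"
    using elem_add_left[of "\<zero>\<^bsub>M\<^esub>" "\<zero>\<^bsub>M\<^esub>" y] assms by simp
  then show ?thesis
    using assms elem_closed MN.add.l_cancel_one' by (metis M.zero_closed)
qed

lemma elem_zero_right:
  assumes "x \<in> carrier M"
  shows "tens x \<zero>\<^bsub>N\<^esub> = \<zero>\<^bsub>MN\<^esub>"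
proof -
  interpret MN: abelian_group MN by (rule abelian_group_tensor)
  have "tens x \<zero>\<^bsub>N\<^esub> \<oplus>\<^bsub>MN\<^esub> tens x \<zero>\<^bsub>N\<^esub> = tens x \<zero>\<^bsub>N\<^esub>"
    using elem_add_right[of x "\<zero>\<^bsub>N\<^esub>" "\<zero>\<^bsub>N\<^esub>"] assms by simp
  then show ?thesis
    using assms elem_closed MN.add.l_cancel_one' by (metis N.zero_closed)
qed

text \<open>Negatives need no case, because \<open>-(x \<otimes> y) = (-x) \<otimes> y\<close>.\<close>

lemma tensor_induct [consumes 1, case_names elem add]:
  assumes X: "X \<in> carrier MN"
    and elem: "\<And>x y. \<lbrakk>x \<in> carrier M; y \<in> carrier N\<rbrakk> \<Longrightarrow> P (tens x y)"
    and add: "\<And>X Y. \<lbrakk>X \<in> carrier MN; Y \<in> carrier MN; P X; P Y\<rbrakk> \<Longrightarrow> P (X \<oplus>\<^bsub>MN\<^esub> Y)"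
  shows "P X"
proof -
  interpret MN: abelian_group MN by (rule abelian_group_tensor)
  let ?c = "\<lambda>u. H #>\<^bsub>F\<^esub> u"
  have c: "?c u \<in> carrier MN" if "Poly_Mapping.keys u \<subseteq> carrier M \<times> carrier N" for u
    using that by (auto simp: carrier_tensor_group)
  have minus: "?c (- frag_of (x, y)) = tens (\<ominus>\<^bsub>M\<^esub> x) y" if "x \<in> carrier M" "y \<in> carrier N" for x y
  proof -
    have "?c (- frag_of (x, y)) \<oplus>\<^bsub>MN\<^esub> tens x y = tens (\<ominus>\<^bsub>M\<^esub> x) y \<oplus>\<^bsub>MN\<^esub> tens x y"
      using that elem_add_left[of "\<ominus>\<^bsub>M\<^esub> x" x y] coset_add[of "- frag_of (x, y)" "frag_of (x, y)"]
      by (simp add: tensor_elem_def coset_zero M.l_neg elem_zero_left[unfolded tensor_elem_def])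
    then show ?thesis
      using that c[of "- frag_of (x, y)"] elem_closed by (simp add: MN.add.right_cancel)
  qed
  obtain u where u: "u \<in> carrier F" "X = ?c u"
    using X by (auto simp: carrier_tensor_group)
  have keys: "Poly_Mapping.keys u \<subseteq> carrier M \<times> carrier N" using u(1) by simp
  \<comment> \<open>The induction on the free group goes through differences, hence the claim for \<open>- u\<close> as well.\<close>
  then have "Poly_Mapping.keys u \<subseteq> carrier M \<times> carrier N \<and> P (?c u) \<and> P (?c (- u))"
  proof (induction u rule: frag_induction)
    case zero
    have "?c 0 = tens \<zero>\<^bsub>M\<^esub> \<zero>\<^bsub>N\<^esub>"
      by (simp add: elem_zero_left coset_zero)
    then show ?case using elem by simp
  next
    case (one p)
    then show ?case
      using elem[of "fst p" "snd p"] elem[of "\<ominus>\<^bsub>M\<^esub> (fst p)" "snd p"] minus[of "fst p" "snd p"]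
      by (auto simp: tensor_elem_def)
  next
    case (diff a b)
    have a: "?c (a - b) = ?c a \<oplus>\<^bsub>MN\<^esub> ?c (- b)" "?c (- (a - b)) = ?c (- a) \<oplus>\<^bsub>MN\<^esub> ?c b"
      using diff by (auto simp: coset_add)
    moreover have "Poly_Mapping.keys (a - b) \<subseteq> carrier M \<times> carrier N"
      using diff keys_diff[of a b] by blast
    ultimately show ?case
      using diff by (auto intro!: add c)
  qed
  then show ?thesis using u by simp
qed

lemma hom_eqI:
  assumes "h \<in> hom (add_monoid MN) (add_monoid G)" "k \<in> hom (add_monoid MN) (add_monoid G)"
    and "\<And>x y. \<lbrakk>x \<in> carrier M; y \<in> carrier N\<rbrakk> \<Longrightarrow> h (tens x y) = k (tens x y)"
    and X: "X \<in> carrier MN"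
  shows "h X = k X"
  using X by (induction X rule: tensor_induct) (use assms in \<open>auto simp: hom_def\<close>)

context
  fixes G :: "('g, 'w) ring_scheme" and f
  assumes G: "abelian_group G" and f: "balanced R M N G f"
begin

interpretation G: abelian_group G by (rule G)

abbreviation (input) "ext u \<equiv>
  \<Oplus>\<^bsub>G\<^esub>p\<in>Poly_Mapping.keys u. [Poly_Mapping.lookup u p] \<cdot>\<^bsub>G\<^esub> f (fst p) (snd p)"

lemma ext_hom: "(\<lambda>u. ext u) \<in> hom F (add_monoid G)"
  and ext_frag_of: "\<lbrakk>x \<in> carrier M; y \<in> carrier N\<rbrakk> \<Longrightarrow> ext (frag_of (x, y)) = f x y"
proof -
  have "(\<lambda>p. f (fst p) (snd p)) \<in> carrier M \<times> carrier N \<rightarrow> carrier G"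
    using f by (auto simp: balanced_def)
  from G.free_extension[OF this] show "(\<lambda>u. ext u) \<in> hom F (add_monoid G)"
    and "\<lbrakk>x \<in> carrier M; y \<in> carrier N\<rbrakk> \<Longrightarrow> ext (frag_of (x, y)) = f x y"
    by auto
qed

text \<open>The extension of a balanced map vanishes on the defining relations, hence on the subgroup that
  they generate.\<close>

lemma ext_subgroup: "u \<in> H \<Longrightarrow> ext u = \<zero>\<^bsub>G\<^esub>"
proof -
  interpret E: group_hom F "add_monoid G" "\<lambda>u. ext u"
    by (simp add: group_hom_def group_hom_axioms_def ext_hom G.a_group)
  have E_add: "ext (u + v) = ext u \<oplus>\<^bsub>G\<^esub> ext v" if "u \<in> carrier F" "v \<in> carrier F" for u v
    using E.hom_mult[OF that] by simp
  have E_diff: "ext (u - v) = ext u \<ominus>\<^bsub>G\<^esub> ext v" if "u \<in> carrier F" "v \<in> carrier F" for u v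
    using E.hom_mult[of u "- v"] E.hom_inv[of v] that by (simp add: a_minus_def a_inv_def)
  have keys2: "Poly_Mapping.keys (frag_of p + frag_of q) \<subseteq> carrier M \<times> carrier N"
    if "p \<in> carrier M \<times> carrier N" "q \<in> carrier M \<times> carrier N" for p q
    using that by (auto dest!: subsetD[OF keys_add])
  have "tensor_relations R M N \<subseteq> kernel F (add_monoid G) (\<lambda>u. ext u)"
  proof
    fix u assume u: "u \<in> tensor_relations R M N"
    then have "ext u = \<zero>\<^bsub>G\<^esub>"
      unfolding tensor_relations_def
      using f by (auto simp: E_diff E_add ext_frag_of keys2 M.rsmult_closed N.lsmult_closed balanced_def
          G.minus_eq G.r_neg)
    then show "u \<in> kernel F (add_monoid G) (\<lambda>u. ext u)"
      using subsetD[OF relations_subset u] by (simp add: kernel_def)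
  qed
  then have "H \<subseteq> kernel F (add_monoid G) (\<lambda>u. ext u)"
    unfolding tensor_subgroup_def
    by (rule group.generate_subgroup_incl[OF group_free_Abelian_group _ E.subgroup_kernel])
  then show "u \<in> H \<Longrightarrow> ext u = \<zero>\<^bsub>G\<^esub>"
    by (auto simp: kernel_def)
qed

lemma tensor_lift_coset:
  assumes "u \<in> carrier F"
  shows "tensor_lift G f (H #>\<^bsub>F\<^esub> u) = ext u"
proof -
  have eq: "ext (h + u) = ext u" if "h \<in> H" for h
    using that ext_hom ext_subgroup[OF that] assms subgroup.mem_carrier[OF subgroup_tensor that]
      hom_in_carrier[OF ext_hom assms] hom_mult[OF ext_hom, of h u]
    by simp
  have "(\<lambda>u. ext u) ` (H #>\<^bsub>F\<^esub> u) = (\<lambda>h. ext (h + u)) ` H"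
    by (auto simp: r_coset_def image_image)
  also have "\<dots> = (\<lambda>h. ext u) ` H"
    by (rule image_cong) (simp_all add: eq)
  also have "\<dots> = {ext u}"
    using subgroup.one_closed[OF subgroup_tensor] by auto
  finally have "(\<lambda>u. ext u) ` (H #>\<^bsub>F\<^esub> u) = {ext u}" .
  then show ?thesis
    by (simp add: tensor_lift_def)
qed

lemma tensor_lift_elem:
  "\<lbrakk>x \<in> carrier M; y \<in> carrier N\<rbrakk> \<Longrightarrow> tensor_lift G f (tens x y) = f x y"
  using tensor_lift_coset[of "frag_of (x, y)"] ext_frag_of by (simp add: tensor_elem_def)

lemma tensor_lift_hom: "tensor_lift G f \<in> hom (add_monoid MN) (add_monoid G)"
proof (rule homI)
  fix X assume "X \<in> carrier (add_monoid MN)"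
  then show "tensor_lift G f X \<in> carrier (add_monoid G)"
    using hom_in_carrier[OF ext_hom] by (auto simp: carrier_tensor_group tensor_lift_coset)
next
  fix X Y assume "X \<in> carrier (add_monoid MN)" "Y \<in> carrier (add_monoid MN)"
  then obtain u v where u: "u \<in> carrier F" "X = H #>\<^bsub>F\<^esub> u" and v: "v \<in> carrier F" "Y = H #>\<^bsub>F\<^esub> v"
    by (auto simp: carrier_tensor_group)
  have "u + v \<in> carrier F"
    using u v by (auto dest!: subsetD[OF keys_add])
  then have "tensor_lift G f (X \<oplus>\<^bsub>MN\<^esub> Y) = ext (u + v)"
    by (simp add: u v coset_add tensor_lift_coset del: carrier_free_Abelian_group_iff)
  also have "\<dots> = tensor_lift G f X \<oplus>\<^bsub>G\<^esub> tensor_lift G f Y"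
    using u v hom_mult[OF ext_hom, of u v] by (simp add: tensor_lift_coset)
  finally show "tensor_lift G f (X \<otimes>\<^bsub>add_monoid MN\<^esub> Y) =
      tensor_lift G f X \<otimes>\<^bsub>add_monoid G\<^esub> tensor_lift G f Y"
    by simp
qed

end

end


section \<open>Maps, actions and associativity on tensor products\<close>

lemma tensor_factors_bimodule: "\<lbrakk>bimodule L R M; left_module R N\<rbrakk> \<Longrightarrow> tensor_factors R M N"
  by (simp add: tensor_factors_def bimodule_def)

lemma tensor_map_balanced:
  assumes "tensor_factors R M' N'" "right_linear R M M' f" "left_linear R N N' g"
  shows "balanced R M N (tensor_group R M' N') (\<lambda>x y. tensor_elem R M' N' (f x) (g y))"
proof -
  interpret T': tensor_factors R M' N' by (rule assms)
  show ?thesis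
    by (rule balancedI)
      (simp_all add: right_linearD[OF assms(2)] left_linearD[OF assms(3)]
        T'.elem_closed T'.elem_add_left T'.elem_add_right T'.elem_balanced)
qed

lemma
  assumes "tensor_factors R M N" "tensor_factors R M' N'" "right_linear R M M' f" "left_linear R N N' g"
  shows tensor_map_hom: "tensor_map R M' N' f g \<in>
      hom (add_monoid (tensor_group R M N)) (add_monoid (tensor_group R M' N'))"
    and tensor_map_elem: "\<lbrakk>x \<in> carrier M; y \<in> carrier N\<rbrakk> \<Longrightarrow>
      tensor_map R M' N' f g (tensor_elem R M N x y) = tensor_elem R M' N' (f x) (g y)"
  unfolding tensor_map_def
  using tensor_factors.tensor_lift_hom[OF assms(1) tensor_factors.abelian_group_tensor[OF assms(2)]
      tensor_map_balanced[OF assms(2-4)]]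
    tensor_factors.tensor_lift_elem[OF assms(1) tensor_factors.abelian_group_tensor[OF assms(2)]
      tensor_map_balanced[OF assms(2-4)]]
  by auto

lemma tensor_module_simps [simp]:
  "carrier (tensor_module R M N) = carrier (tensor_group R M N)"
  "ring.add (tensor_module R M N) = ring.add (tensor_group R M N)"
  "ring.zero (tensor_module R M N) = ring.zero (tensor_group R M N)"
  "smult (tensor_module R M N) = (\<lambda>l. tensor_map R M N (\<lambda>x. l \<odot>\<^bsub>M\<^esub> x) (\<lambda>y. y))"
  by (simp_all add: tensor_module_def ring.extend_def module.fields_def)

lemma tensor_bimodule_simps [simp]:
  "carrier (tensor_bimodule R M N) = carrier (tensor_group R M N)"
  "ring.add (tensor_bimodule R M N) = ring.add (tensor_group R M N)"
  "ring.zero (tensor_bimodule R M N) = ring.zero (tensor_group R M N)"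
  "smult (tensor_bimodule R M N) = (\<lambda>l. tensor_map R M N (\<lambda>x. l \<odot>\<^bsub>M\<^esub> x) (\<lambda>y. y))"
  "rsmult (tensor_bimodule R M N) = (\<lambda>X s. tensor_map R M N (\<lambda>x. x) (\<lambda>y. y \<triangleleft>\<^bsub>N\<^esub> s) X)"
  by (simp_all add: tensor_bimodule_def module.extend_def bimodule.fields_def)

lemma
  assumes M: "bimodule L R M" and N: "left_module R N" and l: "l \<in> carrier L"
  shows lsmult_tensor_hom: "tensor_map R M N (\<lambda>x. l \<odot>\<^bsub>M\<^esub> x) (\<lambda>y. y) \<in>
      hom (add_monoid (tensor_group R M N)) (add_monoid (tensor_group R M N))"
    and lsmult_tensor_elem: "\<lbrakk>x \<in> carrier M; y \<in> carrier N\<rbrakk> \<Longrightarrow>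
      tensor_map R M N (\<lambda>x. l \<odot>\<^bsub>M\<^esub> x) (\<lambda>y. y) (tensor_elem R M N x y) = tensor_elem R M N (l \<odot>\<^bsub>M\<^esub> x) y"
proof -
  note T = tensor_factors_bimodule[OF M N]
  show "tensor_map R M N (\<lambda>x. l \<odot>\<^bsub>M\<^esub> x) (\<lambda>y. y) \<in>
      hom (add_monoid (tensor_group R M N)) (add_monoid (tensor_group R M N))"
    by (rule tensor_map_hom[OF T T right_linear_lsmult[OF M l] left_linear_id])
  show "\<lbrakk>x \<in> carrier M; y \<in> carrier N\<rbrakk> \<Longrightarrow>
      tensor_map R M N (\<lambda>x. l \<odot>\<^bsub>M\<^esub> x) (\<lambda>y. y) (tensor_elem R M N x y) = tensor_elem R M N (l \<odot>\<^bsub>M\<^esub> x) y"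
    by (rule tensor_map_elem[OF T T right_linear_lsmult[OF M l] left_linear_id])
qed

lemma
  assumes M: "right_module R M" and N: "bimodule R S N" and s: "s \<in> carrier S"
  shows rsmult_tensor_hom: "tensor_map R M N (\<lambda>x. x) (\<lambda>y. y \<triangleleft>\<^bsub>N\<^esub> s) \<in>
      hom (add_monoid (tensor_group R M N)) (add_monoid (tensor_group R M N))"
    and rsmult_tensor_elem: "\<lbrakk>x \<in> carrier M; y \<in> carrier N\<rbrakk> \<Longrightarrow>
      tensor_map R M N (\<lambda>x. x) (\<lambda>y. y \<triangleleft>\<^bsub>N\<^esub> s) (tensor_elem R M N x y) = tensor_elem R M N x (y \<triangleleft>\<^bsub>N\<^esub> s)"
proof -
  have T: "tensor_factors R M N"
    using M N by (simp add: tensor_factors_def bimodule_def)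
  show "tensor_map R M N (\<lambda>x. x) (\<lambda>y. y \<triangleleft>\<^bsub>N\<^esub> s) \<in>
      hom (add_monoid (tensor_group R M N)) (add_monoid (tensor_group R M N))"
    and "\<lbrakk>x \<in> carrier M; y \<in> carrier N\<rbrakk> \<Longrightarrow>
      tensor_map R M N (\<lambda>x. x) (\<lambda>y. y \<triangleleft>\<^bsub>N\<^esub> s) (tensor_elem R M N x y) = tensor_elem R M N x (y \<triangleleft>\<^bsub>N\<^esub> s)"
    by (rule tensor_map_hom[OF T T right_linear_id left_linear_rsmult[OF N s]],
      rule tensor_map_elem[OF T T right_linear_id left_linear_rsmult[OF N s]])
qed

lemma left_module_tensor:
  assumes M: "bimodule L R M" and N: "left_module R N"
  shows "left_module L (tensor_module R M N)"
proof -
  interpret M: bimodule L R M by (rule M)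
  interpret T: tensor_factors R M N by (rule tensor_factors_bimodule[OF M N])
  interpret MN: abelian_group "tensor_group R M N" by (rule T.abelian_group_tensor)
  note h = lsmult_tensor_hom[OF M N]
  note e = lsmult_tensor_elem[OF M N]
  have c: "l \<in> carrier L \<Longrightarrow> X \<in> carrier (tensor_group R M N) \<Longrightarrow>
      tensor_map R M N (\<lambda>x. l \<odot>\<^bsub>M\<^esub> x) (\<lambda>y. y) X \<in> carrier (tensor_group R M N)" for l X
    using hom_in_carrier[OF h] by simp
  have a: "tensor_map R M N (\<lambda>x. l \<odot>\<^bsub>M\<^esub> x) (\<lambda>y. y) (X \<oplus>\<^bsub>tensor_group R M N\<^esub> Y) =
      tensor_map R M N (\<lambda>x. l \<odot>\<^bsub>M\<^esub> x) (\<lambda>y. y) X \<oplus>\<^bsub>tensor_group R M N\<^esub>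
      tensor_map R M N (\<lambda>x. l \<odot>\<^bsub>M\<^esub> x) (\<lambda>y. y) Y"
    if "l \<in> carrier L" "X \<in> carrier (tensor_group R M N)" "Y \<in> carrier (tensor_group R M N)" for l X Y
    using hom_mult[OF h[OF that(1)]] that by simp
  show ?thesis
  proof (intro left_module.intro left_module_axioms.intro M.R.ring_axioms, goal_cases)
    case 1
    show ?case by (rule abelian_group_cong[OF MN.abelian_group_axioms]) simp_all
  next
    case (3 l l' X)
    from 3(3)[simplified] show ?case
      by (induction X rule: T.tensor_induct)
        (use 3(1,2) in \<open>simp_all add: a c e M.lsmult_closed M.lsmult_l_distr T.elem_add_left MN.a_ac\<close>)
  next
    case (5 l l' X)
    from 5(3)[simplified] show ?case
      by (induction X rule: T.tensor_induct)
        (use 5(1,2) in \<open>simp_all add: a c e M.lsmult_closed M.lsmult_assoc\<close>)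
  next
    case (6 X)
    from 6[simplified] show ?case
      by (induction X rule: T.tensor_induct) (simp_all add: a c e M.lsmult_one)
  qed (simp_all add: a c)
qed

lemma right_module_tensor:
  assumes M: "right_module R M" and N: "bimodule R S N"
  shows "right_module S (tensor_bimodule R M N)"
proof -
  interpret N: bimodule R S N by (rule N)
  interpret T: tensor_factors R M N
    using M N.left_module_axioms by (rule tensor_factors.intro)
  interpret MN: abelian_group "tensor_group R M N" by (rule T.abelian_group_tensor)
  note h = rsmult_tensor_hom[OF M N]
  note e = rsmult_tensor_elem[OF M N]
  have c: "s \<in> carrier S \<Longrightarrow> X \<in> carrier (tensor_group R M N) \<Longrightarrow>
      tensor_map R M N (\<lambda>x. x) (\<lambda>y. y \<triangleleft>\<^bsub>N\<^esub> s) X \<in> carrier (tensor_group R M N)" for s X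
    using hom_in_carrier[OF h] by simp
  have a: "tensor_map R M N (\<lambda>x. x) (\<lambda>y. y \<triangleleft>\<^bsub>N\<^esub> s) (X \<oplus>\<^bsub>tensor_group R M N\<^esub> Y) =
      tensor_map R M N (\<lambda>x. x) (\<lambda>y. y \<triangleleft>\<^bsub>N\<^esub> s) X \<oplus>\<^bsub>tensor_group R M N\<^esub>
      tensor_map R M N (\<lambda>x. x) (\<lambda>y. y \<triangleleft>\<^bsub>N\<^esub> s) Y"
    if "s \<in> carrier S" "X \<in> carrier (tensor_group R M N)" "Y \<in> carrier (tensor_group R M N)" for s X Y
    using hom_mult[OF h[OF that(1)]] that by simp
  show ?thesis
  proof (intro right_module.intro right_module_axioms.intro N.S.ring_axioms, goal_cases)
    case 1
    show ?case by (rule abelian_group_cong[OF MN.abelian_group_axioms]) simp_all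
  next
    case (3 X s s')
    from 3(1)[simplified] show ?case
      by (induction X rule: T.tensor_induct)
        (use 3(2,3) in \<open>simp_all add: a c e N.rsmult_closed N.rsmult_r_distr T.elem_add_right MN.a_ac\<close>)
  next
    case (5 X s s')
    from 5(1)[simplified] show ?case
      by (induction X rule: T.tensor_induct)
        (use 5(2,3) in \<open>simp_all add: a c e N.rsmult_closed N.rsmult_assoc\<close>)
  next
    case (6 X)
    from 6[simplified] show ?case
      by (induction X rule: T.tensor_induct) (simp_all add: a c e N.rsmult_one)
  qed (simp_all add: a c)
qed

text \<open>For fixed \<open>z\<close> the inner lift in \<open>tensor_assoc\<close> sends \<open>x \<otimes> y\<close> to
  \<open>x \<otimes> (y \<otimes> z)\<close>. That it is balanced in \<open>w\<close> and \<open>z\<close> is checked on elementary tensors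
  \<open>w\<close>.\<close>

lemma
  assumes X: "right_module R X" and Y: "bimodule R S Y" and Z: "left_module S Z"
  defines "XY \<equiv> tensor_bimodule R X Y" and "YZ \<equiv> tensor_module S Y Z"
  shows tensor_assoc_hom: "tensor_assoc R S X Y Z \<in>
      hom (add_monoid (tensor_group S XY Z)) (add_monoid (tensor_group R X YZ))"
    and tensor_assoc_elem: "\<lbrakk>x \<in> carrier X; y \<in> carrier Y; z \<in> carrier Z\<rbrakk> \<Longrightarrow>
      tensor_assoc R S X Y Z (tensor_elem S XY Z (tensor_elem R X Y x y) z) =
        tensor_elem R X YZ x (tensor_elem S Y Z y z)"
proof -
  interpret Y: bimodule R S Y by (rule Y)
  interpret Z: left_module S Z by (rule Z)
  interpret TXY: tensor_factors R X Y
    using X Y.left_module_axioms by (rule tensor_factors.intro)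
  interpret TYZ: tensor_factors S Y Z by (rule tensor_factors_bimodule[OF Y Z])
  interpret T1: tensor_factors S XY Z
    unfolding XY_def using right_module_tensor[OF X Y] Z by (rule tensor_factors.intro)
  interpret T2: tensor_factors R X YZ
    unfolding YZ_def using X left_module_tensor[OF Y Z] by (rule tensor_factors.intro)
  let ?G = "tensor_group R X YZ"
  interpret G: abelian_group ?G by (rule T2.abelian_group_tensor)
  let ?f = "\<lambda>z x y. tensor_elem R X YZ x (tensor_elem S Y Z y z)"
  have YZ[simp]: "carrier YZ = carrier (tensor_group S Y Z)" "ring.add YZ = ring.add (tensor_group S Y Z)"
    "r \<odot>\<^bsub>YZ\<^esub> w = tensor_map S Y Z (\<lambda>x. r \<odot>\<^bsub>Y\<^esub> x) (\<lambda>y. y) w" for r w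
    by (simp_all add: YZ_def)
  have XY[simp]: "carrier XY = carrier (tensor_group R X Y)" "ring.add XY = ring.add (tensor_group R X Y)"
    "w \<triangleleft>\<^bsub>XY\<^esub> s = tensor_map R X Y (\<lambda>x. x) (\<lambda>y. y \<triangleleft>\<^bsub>Y\<^esub> s) w" for s w
    by (simp_all add: XY_def)
  have c: "?f z x y \<in> carrier ?G" if "x \<in> carrier X" "y \<in> carrier Y" "z \<in> carrier Z" for x y z
    using that by (simp add: T2.elem_closed TYZ.elem_closed)
  have bal: "balanced R X Y ?G (?f z)" if z: "z \<in> carrier Z" for z
    by (rule balancedI)
      (use z in \<open>simp_all add: c TYZ.elem_closed T2.elem_add_left T2.elem_add_right[unfolded YZ] T2.elem_balanced
        TYZ.elem_add_left lsmult_tensor_elem[OF Y Z]\<close>)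
  let ?L = "\<lambda>z. tensor_lift ?G (?f z)"
  note L_hom = TXY.tensor_lift_hom[OF G.abelian_group_axioms bal]
  note L_elem = TXY.tensor_lift_elem[OF G.abelian_group_axioms bal]
  have L_closed: "z \<in> carrier Z \<Longrightarrow> w \<in> carrier (tensor_group R X Y) \<Longrightarrow> ?L z w \<in> carrier ?G" for z w
    using hom_in_carrier[OF L_hom] by simp
  have L_add: "?L z (v \<oplus>\<^bsub>tensor_group R X Y\<^esub> w) = ?L z v \<oplus>\<^bsub>?G\<^esub> ?L z w"
    if "z \<in> carrier Z" "v \<in> carrier (tensor_group R X Y)" "w \<in> carrier (tensor_group R X Y)" for z v w
    using hom_mult[OF L_hom[OF that(1)]] that by simp
  have B: "balanced S XY Z ?G (\<lambda>w z. ?L z w)"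
  proof (rule balancedI, goal_cases)
    case (3 w z z')
    from 3(1)[simplified] show ?case
      by (induction w rule: TXY.tensor_induct)
        (use 3(2,3) in \<open>simp_all add: L_elem L_add L_closed TYZ.elem_add_right TYZ.elem_closed
          T2.elem_add_right[unfolded YZ] G.a_ac\<close>)
  next
    case (4 w s z)
    from 4(1)[simplified] show ?case
    proof (induction w rule: TXY.tensor_induct)
      case (elem x y)
      then show ?case using 4(2,3)
        by (simp add: L_elem rsmult_tensor_elem[OF X Y] TYZ.elem_balanced
            Y.rsmult_closed Z.lsmult_closed)
    next
      case (add v w)
      have "v \<in> carrier XY" "w \<in> carrier XY"
        using add by simp_all
      with hom_mult[OF rsmult_tensor_hom[OF X Y 4(2)], of v w] add 4(2,3)
        hom_in_carrier[OF rsmult_tensor_hom[OF X Y 4(2)]]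
      show ?case
        by (simp add: L_add L_closed Z.lsmult_closed)
    qed
  qed (simp_all add: L_closed L_add)
  have eq: "tensor_assoc R S X Y Z = tensor_lift ?G (\<lambda>w z. ?L z w)"
    by (simp add: tensor_assoc_def Let_def YZ_def)
  show "tensor_assoc R S X Y Z \<in>
      hom (add_monoid (tensor_group S XY Z)) (add_monoid (tensor_group R X YZ))"
    unfolding eq by (rule T1.tensor_lift_hom[OF G.abelian_group_axioms B])
  show "tensor_assoc R S X Y Z (tensor_elem S XY Z (tensor_elem R X Y x y) z) =
        tensor_elem R X YZ x (tensor_elem S Y Z y z)"
    if "x \<in> carrier X" "y \<in> carrier Y" "z \<in> carrier Z"
    unfolding eq using that
    by (subst T1.tensor_lift_elem[OF G.abelian_group_axioms B]) (simp_all add: TXY.elem_closed L_elem)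
qed

text \<open>Only the additive structure of the target matters. A direct unfolding does not show this, as
  the additive monoids of records with different fields are terms of different types; uniqueness of
  the induced map does.\<close>

lemma tensor_lift_cong:
  assumes T: "tensor_factors R M N" and G: "abelian_group G" and f: "balanced R M N G f"
    and K: "carrier K = carrier G" "ring.add K = ring.add G" "ring.zero K = ring.zero G"
    and X: "X \<in> carrier (tensor_group R M N)"
  shows "tensor_lift K f X = tensor_lift G f X"
proof -
  have K': "abelian_group K" "balanced R M N K f"
    using abelian_group_cong[OF G K] f by (simp_all add: balanced_def K)
  show ?thesis
    by (rule tensor_factors.hom_eqI[OF T tensor_factors.tensor_lift_hom[OF T K'] _ _ X])
      (use tensor_factors.tensor_lift_hom[OF T G f] in
        \<open>simp_all add: hom_def K tensor_factors.tensor_lift_elem[OF T K'] tensor_factors.tensor_lift_elem[OF T G f]\<close>)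
qed

lemma a_inv_tensor_module [simp]: "a_inv (tensor_module R M N) = a_inv (tensor_group R M N)"
  by (rule ext) (simp add: a_inv_def m_inv_def)

text \<open>A balanced map into \<open>K\<close> that respects the outer \<open>K\<close>-actions induces a
  \<open>K\<close>-bimodule map.\<close>

lemma bimodule_map_tensor_lift:
  assumes M: "bimodule K R M" and N: "bimodule R K N" and K: "ring K"
    and f: "balanced R M N K f"
    and l: "\<And>k x y. \<lbrakk>k \<in> carrier K; x \<in> carrier M; y \<in> carrier N\<rbrakk> \<Longrightarrow> f (k \<odot>\<^bsub>M\<^esub> x) y = k \<otimes>\<^bsub>K\<^esub> f x y"
    and r: "\<And>k x y. \<lbrakk>k \<in> carrier K; x \<in> carrier M; y \<in> carrier N\<rbrakk> \<Longrightarrow> f x (y \<triangleleft>\<^bsub>N\<^esub> k) = f x y \<otimes>\<^bsub>K\<^esub> k"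
  shows "bimodule_map K K (tensor_bimodule R M N) (regular_bimodule K) (tensor_lift K f)"
proof -
  interpret K: ring K by (rule K)
  interpret M: bimodule K R M by (rule M)
  interpret N: bimodule R K N by (rule N)
  interpret T: tensor_factors R M N
    using M.right_module_axioms N.left_module_axioms by (rule tensor_factors.intro)
  let ?L = "tensor_lift K f"
  note lift_elem = T.tensor_lift_elem[OF K.abelian_group_axioms f]
  note hom = add_homD[OF T.tensor_lift_hom[OF K.abelian_group_axioms f]]
  note lhom = add_homD[OF lsmult_tensor_hom[OF M N.left_module_axioms]]
  note rhom = add_homD[OF rsmult_tensor_hom[OF M.right_module_axioms N]]
  have 1: "?L (tensor_map R M N (\<lambda>x. k \<odot>\<^bsub>M\<^esub> x) (\<lambda>y. y) X) = k \<otimes>\<^bsub>K\<^esub> ?L X"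
    if k: "k \<in> carrier K" and X: "X \<in> carrier (tensor_group R M N)" for k X
    using X
  proof (induction X rule: T.tensor_induct)
    case (elem x y)
    then show ?case
      using k by (simp add: lsmult_tensor_elem[OF M N.left_module_axioms] lift_elem M.lsmult_closed l)
  next
    case (add X Y)
    then show ?case
      using k by (simp add: hom lhom K.r_distr)
  qed
  have 2: "?L (tensor_map R M N (\<lambda>x. x) (\<lambda>y. y \<triangleleft>\<^bsub>N\<^esub> k) X) = ?L X \<otimes>\<^bsub>K\<^esub> k"
    if k: "k \<in> carrier K" and X: "X \<in> carrier (tensor_group R M N)" for k X
    using X
  proof (induction X rule: T.tensor_induct)
    case (elem x y)
    then show ?case
      using k by (simp add: rsmult_tensor_elem[OF M.right_module_axioms N] lift_elem N.rsmult_closed r)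
  next
    case (add X Y)
    then show ?case
      using k by (simp add: hom rhom K.l_distr)
  qed
  show ?thesis
    unfolding bimodule_map_def
    by (intro conjI left_linearI right_linearI) (simp_all add: hom 1 2)
qed


section \<open>Comodules\<close>

lemma coring_comodule_simps [simp]:
  "carrier (coring_comodule C) = carrier C"
  "ring.add (coring_comodule C) = ring.add C"
  "ring.zero (coring_comodule C) = ring.zero C"
  "smult (coring_comodule C) = smult C"
  "coact (coring_comodule C) = comult C"
  by (simp_all add: coring_comodule_def)

lemma tensor_coring_comodule [simp]:
  "tensor_elem A M (coring_comodule C) = tensor_elem A M C"
  "tensor_group A M (coring_comodule C) = tensor_group A M C"
  "tensor_map A M (coring_comodule C) = tensor_map A M C"
  "tensor_module A M (coring_comodule C) = tensor_module A M C"
proof -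
  have "tensor_subgroup A M (coring_comodule C) = tensor_subgroup A M C"
    by (simp add: tensor_subgroup_def tensor_relations_def)
  then show e: "tensor_elem A M (coring_comodule C) = tensor_elem A M C"
    and g: "tensor_group A M (coring_comodule C) = tensor_group A M C"
    by (simp_all add: fun_eq_iff tensor_elem_def tensor_group_def)
  show m: "tensor_map A M (coring_comodule C) = tensor_map A M C"
    by (simp add: fun_eq_iff tensor_map_def e g)
  show "tensor_module A M (coring_comodule C) = tensor_module A M C"
    by (simp add: tensor_module_def g m)
qed

lemma left_linear_coring_comodule [simp]:
  "left_linear A (coring_comodule C) N f = left_linear A C N f"
  "left_linear A M (coring_comodule C) g = left_linear A M C g"
  by (simp_all add: left_linear_def hom_def)

lemma left_linear_tensor_bimodule:
  "left_linear A M (tensor_bimodule R X Y) f = left_linear A M (tensor_module R X Y) f"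
  by (simp add: left_linear_def hom_def)

context coring
begin

lemma bimodule_C: "bimodule A A C"
  by (rule bimodule_axioms)

lemma left_module_C: "left_module A C"
  by (rule left_module_axioms)

lemma left_module_coring_comodule: "left_module A (coring_comodule C)"
  by (intro left_module.intro left_module_axioms.intro R.ring_axioms abelian_group_cong[OF M.abelian_group_axioms])
    (simp_all add: lsmult_closed lsmult_l_distr lsmult_r_distr lsmult_assoc lsmult_one)

lemma comult_left_linear: "left_linear A C (tensor_module A C C) (comult C)"
  using comult_map by (simp add: bimodule_map_def left_linear_tensor_bimodule)

lemma tensor_factors_C: "left_module A N \<Longrightarrow> tensor_factors A C N"
  by (rule tensor_factors_bimodule[OF bimodule_C])

lemma counit_linear:
  shows counit_left_linear: "left_linear A C (regular_bimodule A) (counit C)"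
    and counit_right_linear: "right_linear A C (regular_bimodule A) (counit C)"
  using counit_map by (simp_all add: bimodule_map_def)

lemma counit_balanced:
  assumes "left_module A N"
  shows "balanced A C N N (\<lambda>d x. counit C d \<odot>\<^bsub>N\<^esub> x)"
proof -
  interpret N: left_module A N by (rule assms)
  show ?thesis
    using right_linearD[OF counit_right_linear]
    by (intro balancedI) (simp_all add: N.lsmult_closed N.lsmult_l_distr N.lsmult_r_distr N.lsmult_assoc)
qed

text \<open>This instance yields the results on comodules for the functionals on \<open>C\<close> itself.\<close>

lemma left_comodule_coring_comodule: "left_comodule A C (coring_comodule C)"
proof (intro left_comodule.intro left_comodule_axioms.intro coring_axioms left_module_coring_comodule)
  show "left_linear A (coring_comodule C) (tensor_module A C (coring_comodule C)) (coact (coring_comodule C))"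
    by (simp add: comult_left_linear)
next
  fix m assume m: "m \<in> carrier (coring_comodule C)"
  have "tensor_assoc A A C C (coring_comodule C) = tensor_assoc A A C C C"
    by (simp add: tensor_assoc_def)
  then show "tensor_assoc A A C C (coring_comodule C)
      (tensor_map A (tensor_bimodule A C C) (coring_comodule C) (comult C) (\<lambda>x. x) (coact (coring_comodule C) m)) =
    tensor_map A C (tensor_module A C (coring_comodule C)) (\<lambda>d. d) (coact (coring_comodule C))
      (coact (coring_comodule C) m)"
    using coassoc m by simp
  have "tensor_lift (coring_comodule C) (\<lambda>d x. counit C d \<odot>\<^bsub>C\<^esub> x) (comult C m) =
      tensor_lift C (\<lambda>d x. counit C d \<odot>\<^bsub>C\<^esub> x) (comult C m)"
    by (rule tensor_lift_cong[OF tensor_factors_C[OF left_module_C] M.abelian_group_axioms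
          counit_balanced[OF left_module_C]])
      (use m left_linearD(2)[OF comult_left_linear] in simp_all)
  then show "tensor_lift (coring_comodule C) (\<lambda>d x. counit C d \<odot>\<^bsub>coring_comodule C\<^esub> x) (coact (coring_comodule C) m) = m"
    using counit_left m by simp
qed

text \<open>The map \<open>id \<otimes> f : C \<otimes> N \<rightarrow> C \<otimes> K\<close> for a linear map \<open>f\<close>. In particular
  it is functorial and additive in \<open>f\<close>, so that colinear maps can be composed, added and negated.\<close>

lemma
  assumes N: "left_module A N" and K: "left_module A K" and f: "left_linear A N K f"
  shows tensor_id_elem: "\<lbrakk>c \<in> carrier C; x \<in> carrier N\<rbrakk> \<Longrightarrow>
      tensor_map A C K (\<lambda>d. d) f (tensor_elem A C N c x) = tensor_elem A C K c (f x)"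
    and tensor_id_hom: "tensor_map A C K (\<lambda>d. d) f \<in>
      hom (add_monoid (tensor_group A C N)) (add_monoid (tensor_group A C K))"
    using tensor_map_elem[OF tensor_factors_C[OF N] tensor_factors_C[OF K] right_linear_id f]
      tensor_map_hom[OF tensor_factors_C[OF N] tensor_factors_C[OF K] right_linear_id f]
    by auto

lemma tensor_id_comp:
  assumes N: "left_module A N" and K: "left_module A K" and L: "left_module A L"
    and f: "left_linear A N K f" and g: "left_linear A K L g"
    and X: "X \<in> carrier (tensor_group A C N)"
  shows "tensor_map A C L (\<lambda>d. d) (\<lambda>x. g (f x)) X =
    tensor_map A C L (\<lambda>d. d) g (tensor_map A C K (\<lambda>d. d) f X)"
  using X
proof (induction X rule: tensor_factors.tensor_induct[OF tensor_factors_C[OF N], consumes 1])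
  case (1 x y)
  then show ?case
    using left_linearD[OF f] by (simp add: tensor_id_elem[OF N K f] tensor_id_elem[OF K L g]
        tensor_id_elem[OF N L left_linear_comp[OF f g]])
next
  case (2 X Y)
  then show ?case
    by (simp add: add_homD[OF tensor_id_hom[OF N K f]] add_homD[OF tensor_id_hom[OF K L g]]
        add_homD[OF tensor_id_hom[OF N L left_linear_comp[OF f g]]])
qed

lemma tensor_id_cong:
  assumes N: "left_module A N" and K: "left_module A K"
    and f: "left_linear A N K f" and eq: "\<And>x. x \<in> carrier N \<Longrightarrow> f x = g x"
    and X: "X \<in> carrier (tensor_group A C N)"
  shows "tensor_map A C K (\<lambda>d. d) f X = tensor_map A C K (\<lambda>d. d) g X"
  by (rule tensor_factors.hom_eqI[OF tensor_factors_C[OF N] tensor_id_hom[OF N K f]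
        tensor_id_hom[OF N K left_linear_cong[OF f eq N]] _ X])
    (simp_all add: tensor_id_elem[OF N K f] tensor_id_elem[OF N K left_linear_cong[OF f eq N]] eq)

lemma tensor_id_add:
  assumes N: "left_module A N" and K: "left_module A K"
    and f: "left_linear A N K f" and g: "left_linear A N K g"
    and X: "X \<in> carrier (tensor_group A C N)"
  shows "tensor_map A C K (\<lambda>d. d) (\<lambda>x. f x \<oplus>\<^bsub>K\<^esub> g x) X =
    tensor_map A C K (\<lambda>d. d) f X \<oplus>\<^bsub>tensor_group A C K\<^esub> tensor_map A C K (\<lambda>d. d) g X"
proof -
  note fg = left_linear_add[OF K f g]
  interpret TK: tensor_factors A C K by (rule tensor_factors_C[OF K])
  interpret CK: abelian_group "tensor_group A C K" by (rule TK.abelian_group_tensor)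
  from X show ?thesis
  proof (induction X rule: tensor_factors.tensor_induct[OF tensor_factors_C[OF N], consumes 1])
    case (1 x y)
    then show ?case
      using left_linearD[OF f] left_linearD[OF g]
      by (simp add: tensor_id_elem[OF N K f] tensor_id_elem[OF N K g]
          tensor_id_elem[OF N K fg] TK.elem_add_right)
  next
    case (2 X Y)
    then show ?case
      by (simp add: add_homD[OF tensor_id_hom[OF N K f]] add_homD[OF tensor_id_hom[OF N K g]]
          add_homD[OF tensor_id_hom[OF N K fg]] CK.a_ac)
  qed
qed

lemma tensor_id_zero:
  assumes N: "left_module A N" and K: "left_module A K"
    and X: "X \<in> carrier (tensor_group A C N)"
  shows "tensor_map A C K (\<lambda>d. d) (\<lambda>x. \<zero>\<^bsub>K\<^esub>) X = \<zero>\<^bsub>tensor_group A C K\<^esub>"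
proof -
  note z = left_linear_const_zero[OF K, of N]
  interpret TK: tensor_factors A C K by (rule tensor_factors_C[OF K])
  interpret CK: abelian_group "tensor_group A C K" by (rule TK.abelian_group_tensor)
  from X show ?thesis
    by (induction X rule: tensor_factors.tensor_induct[OF tensor_factors_C[OF N], consumes 1])
      (simp_all add: tensor_id_elem[OF N K z] add_homD[OF tensor_id_hom[OF N K z]] TK.elem_zero_right)
qed

end

context left_comodule
begin

lemma left_module_M: "left_module A M"
  by (rule left_module_axioms)

lemma coact_closed: "m \<in> carrier M \<Longrightarrow> coact M m \<in> carrier (tensor_group A C M)"
  using left_linearD(2)[OF coact_linear] by simp

end

lemma left_comodule_coring: "left_comodule A C M \<Longrightarrow> coring A C"
  and left_comodule_module: "left_comodule A C M \<Longrightarrow> left_module A M"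
  by (simp_all add: left_comodule_def)

lemma colinearD:
  assumes "colinear A C M N f"
  shows "left_linear A M N f"
    and "x \<in> carrier M \<Longrightarrow> coact N (f x) = tensor_map A C N (\<lambda>d. d) f (coact M x)"
  using assms by (auto simp: colinear_def)

lemma colinear_comp:
  assumes M: "left_comodule A C M" and N: "left_comodule A C N" and K: "left_comodule A C K"
    and f: "colinear A C M N f" and g: "colinear A C N K g"
  shows "colinear A C M K (\<lambda>x. g (f x))"
  unfolding colinear_def
proof (intro conjI ballI)
  interpret coring A C by (rule left_comodule_coring[OF M])
  note mods = M[THEN left_comodule_module] N[THEN left_comodule_module] K[THEN left_comodule_module]
  show "left_linear A M K (\<lambda>x. g (f x))"
    by (rule left_linear_comp[OF colinearD(1)[OF f] colinearD(1)[OF g]])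
  fix x assume x: "x \<in> carrier M"
  then show "coact K (g (f x)) = tensor_map A C K (\<lambda>d. d) (\<lambda>x. g (f x)) (coact M x)"
    using left_linearD(2)[OF colinearD(1)[OF f] x]
    by (simp add: colinearD(2)[OF f] colinearD(2)[OF g] left_comodule.coact_closed[OF M]
        tensor_id_comp[OF mods colinearD(1)[OF f] colinearD(1)[OF g]])
qed

lemma colinear_cong:
  assumes M: "left_comodule A C M" and N: "left_comodule A C N"
    and f: "colinear A C M N f" and eq: "\<And>x. x \<in> carrier M \<Longrightarrow> f x = g x"
  shows "colinear A C M N g"
  unfolding colinear_def
proof (intro conjI ballI)
  interpret coring A C by (rule left_comodule_coring[OF M])
  note mods = M[THEN left_comodule_module] N[THEN left_comodule_module]
  show "left_linear A M N g"
    by (rule left_linear_cong[OF colinearD(1)[OF f] eq mods(1)])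
  fix x assume x: "x \<in> carrier M"
  then show "coact N (g x) = tensor_map A C N (\<lambda>d. d) g (coact M x)"
    using colinearD(2)[OF f x] tensor_id_cong[OF mods colinearD(1)[OF f] eq
        left_comodule.coact_closed[OF M x]] by (simp add: eq)
qed

lemma colinear_id:
  assumes M: "left_comodule A C M"
  shows "colinear A C M M (\<lambda>x. x)"
  unfolding colinear_def
proof (intro conjI ballI left_linear_id)
  interpret coring A C by (rule left_comodule_coring[OF M])
  note mod = M[THEN left_comodule_module]
  fix x assume x: "x \<in> carrier M"
  have "(\<lambda>X. X) \<in> hom (add_monoid (tensor_group A C M)) (add_monoid (tensor_group A C M))"
    by (auto simp: hom_def)
  then show "coact M x = tensor_map A C M (\<lambda>d. d) (\<lambda>x. x) (coact M x)"
    using tensor_factors.hom_eqI[OF tensor_factors_C[OF mod] _ tensor_id_hom[OF mod mod left_linear_id],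
        of "\<lambda>X. X" "coact M x"]
    by (simp add: tensor_id_elem[OF mod mod left_linear_id] left_comodule.coact_closed[OF M x])
qed

lemma colinear_add:
  assumes M: "left_comodule A C M" and N: "left_comodule A C N"
    and f: "colinear A C M N f" and g: "colinear A C M N g"
  shows "colinear A C M N (\<lambda>x. f x \<oplus>\<^bsub>N\<^esub> g x)"
  unfolding colinear_def
proof (intro conjI ballI)
  interpret coring A C by (rule left_comodule_coring[OF M])
  note mods = M[THEN left_comodule_module] N[THEN left_comodule_module]
  show "left_linear A M N (\<lambda>x. f x \<oplus>\<^bsub>N\<^esub> g x)"
    by (rule left_linear_add[OF mods(2) colinearD(1)[OF f] colinearD(1)[OF g]])
  fix x assume x: "x \<in> carrier M"
  then show "coact N (f x \<oplus>\<^bsub>N\<^esub> g x) = tensor_map A C N (\<lambda>d. d) (\<lambda>x. f x \<oplus>\<^bsub>N\<^esub> g x) (coact M x)"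
    using left_linearD(2)[OF colinearD(1)[OF f] x] left_linearD(2)[OF colinearD(1)[OF g] x]
    by (simp add: left_linearD(3)[OF left_comodule.coact_linear[OF N]]
        tensor_id_add[OF mods colinearD(1)[OF f] colinearD(1)[OF g]]
        left_comodule.coact_closed[OF M] colinearD(2)[OF f] colinearD(2)[OF g])
qed

lemma colinear_zero:
  assumes M: "left_comodule A C M" and N: "left_comodule A C N"
  shows "colinear A C M N (\<lambda>x. \<zero>\<^bsub>N\<^esub>)"
  unfolding colinear_def
proof (intro conjI ballI)
  interpret coring A C by (rule left_comodule_coring[OF M])
  interpret N: left_comodule A C N by (rule N)
  note mods = M[THEN left_comodule_module] N[THEN left_comodule_module]
  show "left_linear A M N (\<lambda>x. \<zero>\<^bsub>N\<^esub>)"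
    by (rule left_linear_const_zero[OF mods(2)])
  fix x assume x: "x \<in> carrier M"
  have "abelian_group (tensor_module A C N)"
    using left_module_tensor[OF bimodule_C mods(2)] by (simp add: left_module_def)
  then have "coact N \<zero>\<^bsub>N\<^esub> = \<zero>\<^bsub>tensor_group A C N\<^esub>"
    using left_linear_zero[OF N.M.abelian_group_axioms _ N.coact_linear] by simp
  then show "coact N \<zero>\<^bsub>N\<^esub> = tensor_map A C N (\<lambda>d. d) (\<lambda>x. \<zero>\<^bsub>N\<^esub>) (coact M x)"
    by (simp add: tensor_id_zero[OF mods] left_comodule.coact_closed[OF M x])
qed

lemma colinear_uminus:
  assumes M: "left_comodule A C M" and N: "left_comodule A C N" and f: "colinear A C M N f"
  shows "colinear A C M N (\<lambda>x. \<ominus>\<^bsub>N\<^esub> f x)"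
  unfolding colinear_def
proof (intro conjI ballI)
  interpret coring A C by (rule left_comodule_coring[OF M])
  interpret N: left_comodule A C N by (rule N)
  note mods = M[THEN left_comodule_module] N[THEN left_comodule_module]
  note f1 = colinearD(1)[OF f] and nf = left_linear_uminus[OF mods(2) colinearD(1)[OF f]]
  show "left_linear A M N (\<lambda>x. \<ominus>\<^bsub>N\<^esub> f x)"
    by (rule nf)
  interpret CN: abelian_group "tensor_group A C N"
    by (rule tensor_factors.abelian_group_tensor[OF tensor_factors_C[OF mods(2)]])
  fix x assume x: "x \<in> carrier M"
  let ?X = "coact M x"
  have X: "?X \<in> carrier (tensor_group A C M)"
    by (rule left_comodule.coact_closed[OF M x])
  \<comment> \<open>\<open>id \<otimes> (-f)\<close> and \<open>id \<otimes> f\<close> add up to \<open>id \<otimes> 0 = 0\<close>.\<close>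
  have "tensor_map A C N (\<lambda>d. d) (\<lambda>x. \<ominus>\<^bsub>N\<^esub> f x) ?X \<oplus>\<^bsub>tensor_group A C N\<^esub> tensor_map A C N (\<lambda>d. d) f ?X =
      tensor_map A C N (\<lambda>d. d) (\<lambda>x. \<ominus>\<^bsub>N\<^esub> f x \<oplus>\<^bsub>N\<^esub> f x) ?X"
    by (rule tensor_id_add[OF mods nf f1 X, symmetric])
  also have "\<dots> = tensor_map A C N (\<lambda>d. d) (\<lambda>x. \<zero>\<^bsub>N\<^esub>) ?X"
    by (rule tensor_id_cong[OF mods left_linear_add[OF mods(2) nf f1] _ X])
      (simp add: left_linearD(2)[OF f1] N.M.l_neg)
  also have "\<dots> = \<zero>\<^bsub>tensor_group A C N\<^esub>"
    by (rule tensor_id_zero[OF mods X])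
  finally have "\<ominus>\<^bsub>tensor_group A C N\<^esub> tensor_map A C N (\<lambda>d. d) f ?X =
      tensor_map A C N (\<lambda>d. d) (\<lambda>x. \<ominus>\<^bsub>N\<^esub> f x) ?X"
    using add_homD(1)[OF tensor_id_hom[OF mods f1] X] add_homD(1)[OF tensor_id_hom[OF mods nf] X]
    by (intro CN.minus_equality)
  moreover have "abelian_group (tensor_module A C N)"
    using left_module_tensor[OF bimodule_C mods(2)] by (simp add: left_module_def)
  then have "coact N (\<ominus>\<^bsub>N\<^esub> f x) = \<ominus>\<^bsub>tensor_group A C N\<^esub> coact N (f x)"
    using left_linear_minus[OF N.M.abelian_group_axioms _ N.coact_linear left_linearD(2)[OF f1 x]] by simp
  ultimately show "coact N (\<ominus>\<^bsub>N\<^esub> f x) = tensor_map A C N (\<lambda>d. d) (\<lambda>x. \<ominus>\<^bsub>N\<^esub> f x) ?X"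
    by (simp add: colinearD(2)[OF f x])
qed


section \<open>The correspondence between functionals and colinear maps into the coring\<close>

context coring
begin

lemma contract_balanced:
  assumes N: "left_module A N" and \<phi>: "left_linear A N (regular_bimodule A) \<phi>"
  shows "balanced A C N C (\<lambda>c x. c \<triangleleft>\<^bsub>C\<^esub> \<phi> x)"
  using left_linearD[OF \<phi>]
  by (intro balancedI) (simp_all add: rsmult_closed rsmult_l_distr rsmult_r_distr rsmult_assoc)

lemma
  assumes N: "left_module A N" and \<phi>: "left_linear A N (regular_bimodule A) \<phi>"
  shows contract_elem: "\<lbrakk>c \<in> carrier C; x \<in> carrier N\<rbrakk> \<Longrightarrow>
      contract C \<phi> (tensor_elem A C N c x) = c \<triangleleft>\<^bsub>C\<^esub> \<phi> x"
    and contract_hom: "contract C \<phi> \<in> hom (add_monoid (tensor_group A C N)) (add_monoid C)"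
  unfolding contract_def
  using tensor_factors.tensor_lift_elem[OF tensor_factors_C[OF N] M.abelian_group_axioms contract_balanced[OF N \<phi>]]
    tensor_factors.tensor_lift_hom[OF tensor_factors_C[OF N] M.abelian_group_axioms contract_balanced[OF N \<phi>]]
  by auto

lemma contract_linear:
  assumes N: "left_module A N" and \<phi>: "left_linear A N (regular_bimodule A) \<phi>"
  shows "left_linear A (tensor_module A C N) C (contract C \<phi>)"
proof (rule left_linearI)
  note h = add_homD[OF contract_hom[OF N \<phi>]]
  fix r X assume r: "r \<in> carrier A" and "X \<in> carrier (tensor_module A C N)"
  then have "X \<in> carrier (tensor_group A C N)" by simp
  then show "contract C \<phi> (r \<odot>\<^bsub>tensor_module A C N\<^esub> X) = r \<odot>\<^bsub>C\<^esub> contract C \<phi> X"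
  proof (induction X rule: tensor_factors.tensor_induct[OF tensor_factors_C[OF N], consumes 1])
    case (1 c x)
    then show ?case
      using r left_linearD(2)[OF \<phi>]
      by (simp add: lsmult_tensor_elem[OF bimodule_C N] contract_elem[OF N \<phi>] lsmult_closed smult_rsmult)
  next
    case (2 X Y)
    then show ?case
      using r add_homD[OF lsmult_tensor_hom[OF bimodule_C N r]]
      by (simp add: h lsmult_r_distr)
  qed
qed (use add_homD[OF contract_hom[OF N \<phi>]] in simp_all)

text \<open>Elements of the Hom sets are restricted to the carrier; this lemma removes the restriction under
  \<open>contract\<close>.\<close>

lemma contract_cong:
  assumes N: "left_module A N" and \<phi>: "left_linear A N (regular_bimodule A) \<phi>"
    and eq: "\<And>x. x \<in> carrier N \<Longrightarrow> \<phi> x = \<psi> x"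
    and X: "X \<in> carrier (tensor_group A C N)"
  shows "contract C \<phi> X = contract C \<psi> X"
proof -
  note \<psi> = left_linear_cong[OF \<phi> eq N]
  show ?thesis
    by (rule tensor_factors.hom_eqI[OF tensor_factors_C[OF N] contract_hom[OF N \<phi>] contract_hom[OF N \<psi>] _ X])
      (simp_all add: contract_elem[OF N \<phi>] contract_elem[OF N \<psi>] eq)
qed

lemma contract_add:
  assumes N: "left_module A N" and \<phi>: "left_linear A N (regular_bimodule A) \<phi>"
    and \<psi>: "left_linear A N (regular_bimodule A) \<psi>"
    and X: "X \<in> carrier (tensor_group A C N)"
  shows "contract C (\<lambda>x. \<phi> x \<oplus>\<^bsub>A\<^esub> \<psi> x) X = contract C \<phi> X \<oplus>\<^bsub>C\<^esub> contract C \<psi> X"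
proof -
  have \<phi>\<psi>: "left_linear A N (regular_bimodule A) (\<lambda>x. \<phi> x \<oplus>\<^bsub>A\<^esub> \<psi> x)"
    using left_linear_add[OF left_module_regular[OF R.ring_axioms] \<phi> \<psi>] by simp
  from X show ?thesis
  proof (induction X rule: tensor_factors.tensor_induct[OF tensor_factors_C[OF N], consumes 1])
    case (1 c x)
    then show ?case
      using left_linearD(2)[OF \<phi>] left_linearD(2)[OF \<psi>]
      by (simp add: contract_elem[OF N \<phi>] contract_elem[OF N \<psi>] contract_elem[OF N \<phi>\<psi>] rsmult_r_distr)
  next
    case (2 X Y)
    then show ?case
      by (simp add: add_homD[OF contract_hom[OF N \<phi>]] add_homD[OF contract_hom[OF N \<psi>]]
          add_homD[OF contract_hom[OF N \<phi>\<psi>]] M.a_ac)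
  qed
qed

lemma contract_tensor_id:
  assumes N: "left_module A N" and K: "left_module A K" and f: "left_linear A N K f"
    and \<phi>: "left_linear A K (regular_bimodule A) \<phi>"
    and X: "X \<in> carrier (tensor_group A C N)"
  shows "contract C \<phi> (tensor_map A C K (\<lambda>d. d) f X) = contract C (\<lambda>x. \<phi> (f x)) X"
  using X
proof (induction X rule: tensor_factors.tensor_induct[OF tensor_factors_C[OF N], consumes 1])
  case (1 c x)
  then show ?case
    using left_linearD(2)[OF f]
    by (simp add: tensor_id_elem[OF N K f] contract_elem[OF K \<phi>] contract_elem[OF N left_linear_comp[OF f \<phi>]])
next
  case (2 X Y)
  then show ?case
    by (simp add: add_homD[OF tensor_id_hom[OF N K f]] add_homD[OF contract_hom[OF K \<phi>]]
        add_homD[OF contract_hom[OF N left_linear_comp[OF f \<phi>]]])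
qed

text \<open>\<open>\<Delta>(d \<phi>(x)) = d\<^bsub>(1)\<^esub> \<otimes> d\<^bsub>(2)\<^esub> \<phi>(x)\<close>, since \<open>\<Delta>\<close> is right linear.\<close>

lemma comult_contract:
  assumes N: "left_module A N" and \<phi>: "left_linear A N (regular_bimodule A) \<phi>"
    and X: "X \<in> carrier (tensor_group A C N)"
  shows "comult C (contract C \<phi> X) =
    tensor_map A C C (\<lambda>d. d) (contract C \<phi>)
      (tensor_assoc A A C C N (tensor_map A (tensor_bimodule A C C) N (comult C) (\<lambda>x. x) X))"
proof -
  note CN = left_module_tensor[OF bimodule_C N] and C = left_module_C
  note \<Delta>l = comult_left_linear
  have \<Delta>r: "right_linear A C (tensor_bimodule A C C) (comult C)"
    using comult_map by (simp add: bimodule_map_def)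
  have rC: "right_module A C" by (rule right_module_axioms)
  have T: "tensor_factors A (tensor_bimodule A C C) N"
    using right_module_tensor[OF rC bimodule_C] N by (rule tensor_factors.intro)
  note map_elem = tensor_map_elem[OF tensor_factors_C[OF N] T \<Delta>r left_linear_id]
  note map_hom = add_homD[OF tensor_map_hom[OF tensor_factors_C[OF N] T \<Delta>r left_linear_id]]
  note assoc_elem = tensor_assoc_elem[OF rC bimodule_C N]
  note assoc_hom = add_homD[OF tensor_assoc_hom[OF rC bimodule_C N]]
  note con_elem = tensor_id_elem[OF CN C contract_linear[OF N \<phi>], simplified]
  note con_hom = add_homD[OF tensor_id_hom[OF CN C contract_linear[OF N \<phi>]]]
  from X show ?thesis
  proof (induction X rule: tensor_factors.tensor_induct[OF tensor_factors_C[OF N], consumes 1])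
    case (1 d x)
    \<comment> \<open>With \<open>w = \<Delta>(d)\<close> this is the claim at \<open>d \<otimes> x\<close>; for arbitrary \<open>w\<close> it
      can be checked on elementary tensors.\<close>
    have *: "tensor_map A C C (\<lambda>d. d) (contract C \<phi>)
        (tensor_assoc A A C C N (tensor_elem A (tensor_bimodule A C C) N w x)) =
      tensor_map A C C (\<lambda>d. d) (\<lambda>y. y \<triangleleft>\<^bsub>C\<^esub> \<phi> x) w"
      if "w \<in> carrier (tensor_group A C C)" for w
      using that
    proof (induction w rule: tensor_factors.tensor_induct[OF tensor_factors_C[OF C], consumes 1])
      case (1 c c')
      then show ?case
        using \<open>x \<in> carrier N\<close> left_linearD(2)[OF \<phi>, of x]
        by (simp add: assoc_elem con_elem contract_elem[OF N \<phi>] rsmult_tensor_elem[OF rC bimodule_C]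
            tensor_factors.elem_closed[OF tensor_factors_C[OF N]])
    next
      case (2 v w)
      have "tensor_elem A (tensor_bimodule A C C) N (v \<oplus>\<^bsub>tensor_group A C C\<^esub> w) x =
          tensor_elem A (tensor_bimodule A C C) N v x
            \<oplus>\<^bsub>tensor_group A (tensor_bimodule A C C) N\<^esub> tensor_elem A (tensor_bimodule A C C) N w x"
        using tensor_factors.elem_add_left[OF T, of v w x] 2 \<open>x \<in> carrier N\<close> by simp
      moreover have "tensor_elem A (tensor_bimodule A C C) N u x
          \<in> carrier (tensor_group A (tensor_bimodule A C C) N)"
        if "u \<in> carrier (tensor_group A C C)" for u
        using tensor_factors.elem_closed[OF T, of u x] that \<open>x \<in> carrier N\<close> by simp
      ultimately show ?case
        using 2 \<open>x \<in> carrier N\<close> left_linearD(2)[OF \<phi>, of x]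
          add_homD[OF rsmult_tensor_hom[OF rC bimodule_C, of "\<phi> x"]]
        by (simp add: assoc_hom con_hom)
    qed
    show ?case
      using 1 left_linearD(2)[OF \<phi>, of x] left_linearD(2)[OF \<Delta>l, of d] right_linearD(4)[OF \<Delta>r, of d "\<phi> x"]
      by (simp add: contract_elem[OF N \<phi>] map_elem *)
  next
    case (2 X Y)
    then show ?case
      by (simp add: add_homD[OF contract_hom[OF N \<phi>]] left_linearD[OF \<Delta>l, simplified] map_hom assoc_hom con_hom)
  qed
qed

end

context left_comodule
begin

lemma contract_closed:
  "\<lbrakk>left_linear A M (regular_bimodule A) \<phi>; m \<in> carrier M\<rbrakk> \<Longrightarrow> contract C \<phi> (coact M m) \<in> carrier C"
  using add_homD(1)[OF contract_hom[OF left_module_M]] coact_closed by blast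

text \<open>\<open>\<Delta>(m\<^bsub>[-1]\<^esub> \<phi>(m\<^bsub>[0]\<^esub>)) = m\<^bsub>[-1](1)\<^esub> \<otimes> m\<^bsub>[-1](2)\<^esub> \<phi>(m\<^bsub>[0]\<^esub>)
  = m\<^bsub>[-1]\<^esub> \<otimes> m\<^bsub>[0][-1]\<^esub> \<phi>(m\<^bsub>[0][0]\<^esub>)\<close>, the second step by coassociativity.\<close>

lemma contract_colinear:
  assumes \<phi>: "left_linear A M (regular_bimodule A) \<phi>"
  shows "colinear A C M (coring_comodule C) (\<lambda>m. contract C \<phi> (coact M m))"
  unfolding colinear_def
proof (intro conjI ballI)
  note M = left_module_M and CM = left_module_tensor[OF bimodule_C left_module_M]
  show "left_linear A M (coring_comodule C) (\<lambda>m. contract C \<phi> (coact M m))"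
    using left_linear_comp[OF coact_linear contract_linear[OF M \<phi>]] by simp
  fix m assume m: "m \<in> carrier M"
  then have X: "coact M m \<in> carrier (tensor_group A C M)" by (rule coact_closed)
  have "tensor_map A C C (\<lambda>d. d) (\<lambda>m. contract C \<phi> (coact M m)) (coact M m) =
      tensor_map A C C (\<lambda>d. d) (contract C \<phi>)
        (tensor_map A C (tensor_module A C M) (\<lambda>d. d) (coact M) (coact M m))"
    by (rule tensor_id_comp[OF M CM left_module_C coact_linear contract_linear[OF M \<phi>] X])
  also have "\<dots> = comult C (contract C \<phi> (coact M m))"
    by (simp add: comult_contract[OF M \<phi> X] coact_coassoc[OF m])
  finally show "coact (coring_comodule C) (contract C \<phi> (coact M m)) =
      tensor_map A C (coring_comodule C) (\<lambda>d. d) (\<lambda>m. contract C \<phi> (coact M m)) (coact M m)"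
    by simp
qed

lemma counit_contract:
  assumes \<phi>: "left_linear A M (regular_bimodule A) \<phi>" and m: "m \<in> carrier M"
  shows "counit C (contract C \<phi> (coact M m)) = \<phi> m"
proof -
  let ?E = "tensor_lift M (\<lambda>d x. counit C d \<odot>\<^bsub>M\<^esub> x)"
  note N = left_module_M
  note E_elem = tensor_factors.tensor_lift_elem[OF tensor_factors_C[OF N] M.abelian_group_axioms counit_balanced[OF N]]
  note E_hom = add_homD[OF tensor_factors.tensor_lift_hom[OF tensor_factors_C[OF N] M.abelian_group_axioms counit_balanced[OF N]]]
  note \<epsilon> = left_linearD[OF counit_left_linear, simplified] right_linearD[OF counit_right_linear, simplified]
  have "counit C (contract C \<phi> X) = \<phi> (?E X)" if "X \<in> carrier (tensor_group A C M)" for X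
    using that
  proof (induction X rule: tensor_factors.tensor_induct[OF tensor_factors_C[OF N], consumes 1])
    case (1 d x)
    then show ?case
      by (simp add: contract_elem[OF N \<phi>] E_elem \<epsilon> left_linearD[OF \<phi>, simplified])
  next
    case (2 X Y)
    then show ?case
      by (simp add: add_homD[OF contract_hom[OF N \<phi>]] E_hom \<epsilon> left_linearD[OF \<phi>, simplified])
  qed
  then show ?thesis
    using coact_closed[OF m] coact_counit[OF m] by simp
qed

text \<open>\<open>F\<^bsub>\<phi> \<circ> t\<^esub> = F\<^sub>\<phi> \<circ> t\<close> for colinear \<open>t\<close>.\<close>

lemma contract_comp:
  assumes N: "left_comodule A C N" and t: "colinear A C M N t"
    and \<phi>: "left_linear A N (regular_bimodule A) \<phi>" and m: "m \<in> carrier M"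
  shows "contract C (\<lambda>x. \<phi> (t x)) (coact M m) = contract C \<phi> (coact N (t m))"
  using contract_tensor_id[OF left_module_M left_comodule_module[OF N] colinearD(1)[OF t] \<phi> coact_closed[OF m]]
    colinearD(2)[OF t m] by simp

lemma contract_restrict:
  assumes \<phi>: "left_linear A M (regular_bimodule A) \<phi>" and m: "m \<in> carrier M"
  shows "contract C (restrict \<phi> (carrier M)) (coact M m) = contract C \<phi> (coact M m)"
  by (rule contract_cong[OF left_module_M \<phi> _ coact_closed[OF m], symmetric]) simp

end


section \<open>Abelian groups of linear and colinear maps\<close>

lemma pointwise_add_apply [simp]: "x \<in> carrier M \<Longrightarrow> pointwise_add M N f g x = f x \<oplus>\<^bsub>N\<^esub> g x"
  by (simp add: pointwise_add_def)

lemma pointwise_add_extensional [simp]: "pointwise_add M N f g \<in> extensional (carrier M)"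
  by (simp add: pointwise_add_def)

lemma abelian_group_pointwise:
  assumes N: "abelian_group N"
    and G: "ring.add G = pointwise_add M N" "ring.zero G = pointwise_zero M N"
    and ext: "\<And>f. f \<in> carrier G \<Longrightarrow> f \<in> extensional (carrier M)"
    and closed: "\<And>f x. \<lbrakk>f \<in> carrier G; x \<in> carrier M\<rbrakk> \<Longrightarrow> f x \<in> carrier N"
    and add: "\<And>f g. \<lbrakk>f \<in> carrier G; g \<in> carrier G\<rbrakk> \<Longrightarrow> pointwise_add M N f g \<in> carrier G"
    and zero: "pointwise_zero M N \<in> carrier G"
    and minus: "\<And>f. f \<in> carrier G \<Longrightarrow> (\<lambda>x\<in>carrier M. \<ominus>\<^bsub>N\<^esub> f x) \<in> carrier G"
  shows "abelian_group G"
proof -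
  interpret N: abelian_group N by (rule N)
  show ?thesis
  proof (rule abelian_groupI, unfold G)
    show "pointwise_add M N (pointwise_zero M N) f = f" if "f \<in> carrier G" for f
      by (rule extensionalityI[of _ "carrier M"])
        (use that in \<open>simp_all add: pointwise_add_def pointwise_zero_def ext closed\<close>)
    show "\<exists>g\<in>carrier G. pointwise_add M N g f = pointwise_zero M N" if "f \<in> carrier G" for f
      by (rule bexI[OF _ minus[OF that]])
        (use that in \<open>auto simp: pointwise_add_def pointwise_zero_def closed N.l_neg intro!: restrict_ext\<close>)
  qed (auto simp: add[unfolded pointwise_add_def] zero pointwise_add_def closed N.a_ac intro!: restrict_ext)
qed

lemma linear_HomD:
  assumes "f \<in> linear_Hom R M N"
  shows "f \<in> extensional (carrier M)" "left_linear R M N f"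
  using assms by (simp_all add: linear_Hom_def)

lemma colinear_HomD:
  assumes "f \<in> colinear_Hom A C M N"
  shows "f \<in> extensional (carrier M)" "colinear A C M N f" "left_linear A M N f"
  using assms by (simp_all add: colinear_Hom_def colinear_def)

lemma restrict_linear_Hom:
  assumes "left_module R M" "left_linear R M N f"
  shows "restrict f (carrier M) \<in> linear_Hom R M N"
  using left_linear_cong[OF assms(2) _ assms(1)] by (simp add: linear_Hom_def)

lemma restrict_colinear_Hom:
  assumes "left_comodule A C M" "left_comodule A C N" "colinear A C M N f"
  shows "restrict f (carrier M) \<in> colinear_Hom A C M N"
  using colinear_cong[OF assms] by (simp add: colinear_Hom_def)

lemma abelian_group_linear_Hom:
  assumes M: "left_module R M" and N: "left_module R N"
    and G: "carrier G = linear_Hom R M N" "ring.add G = pointwise_add M N" "ring.zero G = pointwise_zero M N"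
  shows "abelian_group G"
proof -
  interpret N: left_module R N by (rule N)
  note r = restrict_linear_Hom[OF M]
  show ?thesis
    by (rule abelian_group_pointwise[OF N.M.abelian_group_axioms G(2,3)], unfold G(1))
      (auto simp: pointwise_add_def pointwise_zero_def dest: linear_HomD left_linearD(2)
        intro!: r left_linear_add[OF N] left_linear_uminus[OF N] left_linear_const_zero[OF N])
qed

lemma abelian_group_colinear_Hom:
  assumes M: "left_comodule A C M" and N: "left_comodule A C N"
    and G: "carrier G = colinear_Hom A C M N" "ring.add G = pointwise_add M N" "ring.zero G = pointwise_zero M N"
  shows "abelian_group G"
proof -
  interpret N: left_comodule A C N by (rule N)
  note r = restrict_colinear_Hom[OF M N]
  show ?thesis
    by (rule abelian_group_pointwise[OF N.M.abelian_group_axioms G(2,3)], unfold G(1))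
      (auto simp: pointwise_add_def pointwise_zero_def dest: colinear_HomD left_linearD(2)
        intro!: r colinear_add[OF M N] colinear_uminus[OF M N] colinear_zero[OF M N])
qed

lemma pointwise_coring_comodule [simp]:
  "pointwise_add (coring_comodule C) N = pointwise_add C N"
  "pointwise_zero (coring_comodule C) N = pointwise_zero C N"
  by (simp_all add: fun_eq_iff pointwise_add_def pointwise_zero_def)

lemma pointwise_regular [simp]:
  "pointwise_add M (regular_bimodule R) = pointwise_add M R"
  "pointwise_zero M (regular_bimodule R) = pointwise_zero M R"
  by (simp_all add: fun_eq_iff pointwise_add_def pointwise_zero_def)

lemma linear_Hom_coring_comodule [simp]: "linear_Hom A (coring_comodule C) N = linear_Hom A C N"
  by (simp add: linear_Hom_def)

text \<open>The multiplication of \<open>T\<close> is composition in the opposite order.\<close>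

lemma T_ring_simps [simp]:
  "carrier (T_ring A C M) = colinear_Hom A C M M"
  "monoid.mult (T_ring A C M) = (\<lambda>s t. compose (carrier M) t s)"
  "monoid.one (T_ring A C M) = (\<lambda>m\<in>carrier M. m)"
  "ring.add (T_ring A C M) = pointwise_add M M"
  "ring.zero (T_ring A C M) = pointwise_zero M M"
  by (simp_all add: T_ring_def opposite_ring_def comodule_End_def)

lemma left_dual_ring_simps [simp]:
  "carrier (left_dual_ring A C) = linear_Hom A C (regular_bimodule A)"
  "monoid.mult (left_dual_ring A C) = (\<lambda>f g. \<lambda>c\<in>carrier C. g (contract C f (comult C c)))"
  "monoid.one (left_dual_ring A C) = restrict (counit C) (carrier C)"
  "ring.add (left_dual_ring A C) = pointwise_add C A"
  "ring.zero (left_dual_ring A C) = pointwise_zero C A"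
  by (simp_all add: left_dual_ring_def)

lemma dual_bimodule_simps [simp]:
  "carrier (dual_bimodule A C M) = linear_Hom A M (regular_bimodule A)"
  "ring.add (dual_bimodule A C M) = pointwise_add M A"
  "ring.zero (dual_bimodule A C M) = pointwise_zero M A"
  "smult (dual_bimodule A C M) = (\<lambda>t \<phi>. compose (carrier M) \<phi> t)"
  "rsmult (dual_bimodule A C M) = (\<lambda>\<phi> f. \<lambda>m\<in>carrier M. f (contract C \<phi> (coact M m)))"
  by (simp_all add: dual_bimodule_def)

lemma Q_bimodule_simps [simp]:
  "carrier (Q_bimodule A C M) = colinear_Hom A C (coring_comodule C) M"
  "ring.add (Q_bimodule A C M) = pointwise_add C M"
  "ring.zero (Q_bimodule A C M) = pointwise_zero C M"
  "smult (Q_bimodule A C M) = (\<lambda>f q. \<lambda>c\<in>carrier C. q (contract C f (comult C c)))"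
  "rsmult (Q_bimodule A C M) = (\<lambda>q t. compose (carrier C) t q)"
  by (simp_all add: Q_bimodule_def)


section \<open>The operations as compositions\<close>

context left_comodule
begin

abbreviation (input) "T \<equiv> T_ring A C M"
abbreviation (input) "Cd \<equiv> left_dual_ring A C"
abbreviation (input) "Md \<equiv> dual_bimodule A C M"
abbreviation (input) "Q \<equiv> Q_bimodule A C M"
abbreviation (input) "Areg \<equiv> regular_bimodule A"

lemma comodule_M: "left_comodule A C M"
  by (rule left_comodule_axioms)

lemmas comodule_C = left_comodule_coring_comodule

text \<open>The rules for \<open>F\<close> at each kind of composite that occurs in the operations of the context,
  and at sums, stated with the restricted functions that are the elements of the carriers.\<close>

lemma contract_compose:
  "\<lbrakk>t \<in> colinear_Hom A C M M; \<phi> \<in> linear_Hom A M Areg; m \<in> carrier M\<rbrakk> \<Longrightarrow>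
    contract C (compose (carrier M) \<phi> t) (coact M m) = contract C \<phi> (coact M (t m))"
  unfolding compose_def
  by (simp add: contract_restrict[OF left_linear_comp[OF colinear_HomD(3) linear_HomD(2)]]
    contract_comp[OF comodule_M colinear_HomD(2) linear_HomD(2)])

lemma contract_compose_Q:
  assumes "q \<in> colinear_Hom A C (coring_comodule C) M" "\<phi> \<in> linear_Hom A M Areg" "c \<in> carrier C"
  shows "contract C (compose (carrier C) \<phi> q) (comult C c) = contract C \<phi> (coact M (q c))"
proof -
  note l = colinear_HomD(3)[OF assms(1), simplified] linear_HomD(2)[OF assms(2)]
  show ?thesis
    unfolding compose_def
    using left_comodule.contract_restrict[OF comodule_C, of "\<lambda>x. \<phi> (q x)" c]
      left_comodule.contract_comp[OF comodule_C comodule_M colinear_HomD(2)[OF assms(1)] l(2), of c]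
      left_linear_comp[OF l] assms(3)
    by simp
qed

lemma contract_pointwise_add:
  assumes "\<phi> \<in> linear_Hom A M Areg" "\<psi> \<in> linear_Hom A M Areg" "m \<in> carrier M"
  shows "contract C (pointwise_add M A \<phi> \<psi>) (coact M m) =
    contract C \<phi> (coact M m) \<oplus>\<^bsub>C\<^esub> contract C \<psi> (coact M m)"
proof -
  note l = linear_HomD(2)[OF assms(1)] linear_HomD(2)[OF assms(2)]
  have "left_linear A M Areg (\<lambda>x. \<phi> x \<oplus>\<^bsub>A\<^esub> \<psi> x)"
    using left_linear_add[OF left_module_regular[OF R.ring_axioms] l] by simp
  then show ?thesis
    unfolding pointwise_add_def
    using contract_restrict contract_add[OF left_module_M l coact_closed] assms(3) by simp
qed

text \<open>\<open>F\<^bsub>f \<circ> F\<^sub>\<phi>\<^esub> = F\<^sub>f \<circ> F\<^sub>\<phi>\<close>.\<close>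

lemma contract_contract:
  assumes "\<phi> \<in> linear_Hom A M Areg" "f \<in> linear_Hom A C Areg" "m \<in> carrier M"
  shows "contract C (\<lambda>m\<in>carrier M. f (contract C \<phi> (coact M m))) (coact M m) =
    contract C f (comult C (contract C \<phi> (coact M m)))"
proof -
  note l = linear_HomD(2)[OF assms(1)] linear_HomD(2)[OF assms(2)]
  note F = contract_colinear[OF l(1)]
  have "left_linear A M Areg (\<lambda>m. f (contract C \<phi> (coact M m)))"
    using left_linear_comp[OF colinearD(1)[OF F], of Areg f] l by simp
  then show ?thesis
    using contract_restrict[OF _ assms(3)] contract_comp[OF comodule_C F _ assms(3), of f] l by simp
qed

lemma contract_counit_C:
  assumes "c \<in> carrier C"
  shows "contract C (restrict (counit C) (carrier C)) (comult C c) = c"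
  using left_comodule.contract_restrict[OF comodule_C, of "counit C" c] counit_left_linear assms
    counit_right[OF assms, folded contract_def]
  by simp

lemmas contract_closed_C = left_comodule.contract_closed[OF comodule_C, simplified]
lemmas contract_pointwise_add_C = left_comodule.contract_pointwise_add[OF comodule_C, simplified]
lemmas contract_contract_C = left_comodule.contract_contract[OF comodule_C, simplified]

text \<open>Closure and additivity of the elements of the four carriers, and closure of the carriers under the
  eight kinds of composite.\<close>

lemma T_closed: "t \<in> colinear_Hom A C M M \<Longrightarrow> m \<in> carrier M \<Longrightarrow> t m \<in> carrier M"
  by (rule left_linearD(2)[OF colinear_HomD(3)])

lemma Md_closed: "\<phi> \<in> linear_Hom A M Areg \<Longrightarrow> m \<in> carrier M \<Longrightarrow> \<phi> m \<in> carrier A"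
  using left_linearD(2)[OF linear_HomD(2), of \<phi> A M Areg m] by simp

lemma Cd_closed: "f \<in> linear_Hom A C Areg \<Longrightarrow> c \<in> carrier C \<Longrightarrow> f c \<in> carrier A"
  using left_linearD(2)[OF linear_HomD(2), of f A C Areg c] by simp

lemma Q_closed: "q \<in> colinear_Hom A C (coring_comodule C) M \<Longrightarrow> c \<in> carrier C \<Longrightarrow> q c \<in> carrier M"
  using left_linearD(2)[OF colinear_HomD(3), of q A C "coring_comodule C" M c] by simp

lemmas closed = T_closed Md_closed Cd_closed Q_closed
  contract_closed[OF linear_HomD(2)] contract_closed_C[OF linear_HomD(2)]

lemma T_add: "t \<in> colinear_Hom A C M M \<Longrightarrow> m \<in> carrier M \<Longrightarrow> m' \<in> carrier M \<Longrightarrow>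
    t (m \<oplus>\<^bsub>M\<^esub> m') = t m \<oplus>\<^bsub>M\<^esub> t m'"
  by (rule left_linearD(3)[OF colinear_HomD(3)])

lemma Md_add: "\<phi> \<in> linear_Hom A M Areg \<Longrightarrow> m \<in> carrier M \<Longrightarrow> m' \<in> carrier M \<Longrightarrow>
    \<phi> (m \<oplus>\<^bsub>M\<^esub> m') = \<phi> m \<oplus>\<^bsub>A\<^esub> \<phi> m'"
  using left_linearD(3)[OF linear_HomD(2), of \<phi> A M Areg m m'] by simp

lemma Cd_add: "f \<in> linear_Hom A C Areg \<Longrightarrow> c \<in> carrier C \<Longrightarrow> c' \<in> carrier C \<Longrightarrow>
    f (c \<oplus>\<^bsub>C\<^esub> c') = f c \<oplus>\<^bsub>A\<^esub> f c'"
  using left_linearD(3)[OF linear_HomD(2), of f A C Areg c c'] by simp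

lemma Q_add: "q \<in> colinear_Hom A C (coring_comodule C) M \<Longrightarrow> c \<in> carrier C \<Longrightarrow> c' \<in> carrier C \<Longrightarrow>
    q (c \<oplus>\<^bsub>C\<^esub> c') = q c \<oplus>\<^bsub>M\<^esub> q c'"
  using left_linearD(3)[OF colinear_HomD(3), of q A C "coring_comodule C" M c c'] by simp

lemmas additive = T_add Md_add Cd_add Q_add

lemma compose_T_T: "\<lbrakk>s \<in> colinear_Hom A C M M; t \<in> colinear_Hom A C M M\<rbrakk> \<Longrightarrow>
    compose (carrier M) t s \<in> colinear_Hom A C M M"
  unfolding compose_def
  by (rule restrict_colinear_Hom[OF comodule_M comodule_M
        colinear_comp[OF comodule_M comodule_M comodule_M colinear_HomD(2) colinear_HomD(2)]])

lemma compose_T_Md: "\<lbrakk>t \<in> colinear_Hom A C M M; \<phi> \<in> linear_Hom A M Areg\<rbrakk> \<Longrightarrow>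
    compose (carrier M) \<phi> t \<in> linear_Hom A M Areg"
  unfolding compose_def
  by (rule restrict_linear_Hom[OF left_module_M left_linear_comp[OF colinear_HomD(3) linear_HomD(2)]])

lemma compose_Q_T: "\<lbrakk>q \<in> colinear_Hom A C (coring_comodule C) M; t \<in> colinear_Hom A C M M\<rbrakk> \<Longrightarrow>
    compose (carrier C) t q \<in> colinear_Hom A C (coring_comodule C) M"
  unfolding compose_def
  using restrict_colinear_Hom[OF comodule_C comodule_M
      colinear_comp[OF comodule_C comodule_M comodule_M], of q t] by (simp add: colinear_HomD(2))

lemma compose_Q_Md: "\<lbrakk>q \<in> colinear_Hom A C (coring_comodule C) M; \<phi> \<in> linear_Hom A M Areg\<rbrakk> \<Longrightarrow>
    compose (carrier C) \<phi> q \<in> linear_Hom A C Areg"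
  unfolding compose_def
  using colinear_HomD(3)[of q A C "coring_comodule C" M] left_linear_comp[of A C M q Areg \<phi>]
  by (intro restrict_linear_Hom[OF left_module_C]) (simp add: linear_HomD(2))

lemma act_Md_Cd: "\<lbrakk>\<phi> \<in> linear_Hom A M Areg; f \<in> linear_Hom A C Areg\<rbrakk> \<Longrightarrow>
    (\<lambda>m\<in>carrier M. f (contract C \<phi> (coact M m))) \<in> linear_Hom A M Areg"
  using colinearD(1)[OF contract_colinear, of \<phi>]
    left_linear_comp[of A M C "\<lambda>m. contract C \<phi> (coact M m)" Areg f]
  by (intro restrict_linear_Hom[OF left_module_M]) (simp add: linear_HomD(2))

lemma act_Cd_Cd: "\<lbrakk>f \<in> linear_Hom A C Areg; g \<in> linear_Hom A C Areg\<rbrakk> \<Longrightarrow>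
    (\<lambda>c\<in>carrier C. g (contract C f (comult C c))) \<in> linear_Hom A C Areg"
  using left_comodule.act_Md_Cd[OF comodule_C, of f g] by simp

lemma act_Md_Q: "\<lbrakk>\<phi> \<in> linear_Hom A M Areg; q \<in> colinear_Hom A C (coring_comodule C) M\<rbrakk> \<Longrightarrow>
    (\<lambda>m\<in>carrier M. q (contract C \<phi> (coact M m))) \<in> colinear_Hom A C M M"
  by (rule restrict_colinear_Hom[OF comodule_M comodule_M
        colinear_comp[OF comodule_M comodule_C comodule_M
          contract_colinear[OF linear_HomD(2)] colinear_HomD(2)]])

lemma act_Cd_Q: "\<lbrakk>f \<in> linear_Hom A C Areg; q \<in> colinear_Hom A C (coring_comodule C) M\<rbrakk> \<Longrightarrow>
    (\<lambda>c\<in>carrier C. q (contract C f (comult C c))) \<in> colinear_Hom A C (coring_comodule C) M"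
  using restrict_colinear_Hom[OF comodule_C comodule_M
      colinear_comp[OF comodule_C comodule_C comodule_M], of "\<lambda>c. contract C f (comult C c)" q]
    left_comodule.contract_colinear[OF comodule_C, of f]
  by (simp add: linear_HomD(2) colinear_HomD(2))

lemmas closed_maps = compose_T_T compose_T_Md compose_Q_T compose_Q_Md act_Md_Cd act_Cd_Cd act_Md_Q act_Cd_Q

lemmas contract_simps = contract_compose contract_compose_Q contract_pointwise_add contract_contract
  contract_pointwise_add_C contract_contract_C contract_counit_C


section \<open>The Morita context\<close>

lemma ring_T: "ring T"
proof (rule ringI)
  show "abelian_group T"
    by (rule abelian_group_colinear_Hom[OF comodule_M comodule_M]) simp_all
  show "Group.monoid T"
    by (rule monoidI)
      (auto simp: compose_T_T compose_assoc[of _ "carrier M" "carrier M"] T_closed compose_Id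
        Id_compose colinear_HomD(1) Pi_I
        intro!: restrict_colinear_Hom[OF comodule_M comodule_M colinear_id[OF comodule_M]]
        extensionalityI[of _ "carrier M"] simp: compose_eq)
qed (auto intro!: extensionalityI[of _ "carrier M"] simp: compose_eq closed additive)

lemma ring_Cd: "ring Cd"
proof (rule ringI)
  show "abelian_group Cd"
    by (rule abelian_group_linear_Hom[OF left_module_C left_module_regular[OF R.ring_axioms]]) simp_all
  show "Group.monoid Cd"
  proof (rule monoidI)
    show "\<one>\<^bsub>Cd\<^esub> \<in> carrier Cd"
      by (simp add: restrict_linear_Hom[OF left_module_C counit_left_linear])
  qed (auto intro!: extensionalityI[of _ "carrier C"] simp: closed closed_maps contract_simps linear_HomD(1)
      left_comodule.counit_contract[OF comodule_C, simplified] linear_HomD(2))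
qed (auto intro!: extensionalityI[of _ "carrier C"] simp: closed closed_maps contract_simps additive)

lemma bimodule_Md: "bimodule T Cd Md"
proof (intro bimodule.intro left_module.intro right_module.intro ring_T ring_Cd)
  show "abelian_group Md" "abelian_group Md"
    by (rule abelian_group_linear_Hom[OF left_module_M left_module_regular[OF R.ring_axioms]]; simp)+
  show "left_module_axioms T Md"
    by unfold_locales (auto intro!: extensionalityI[of _ "carrier M"]
        simp: closed closed_maps additive compose_eq linear_HomD(1))
  show "right_module_axioms Cd Md"
    by unfold_locales (auto intro!: extensionalityI[of _ "carrier M"]
        simp: closed closed_maps additive contract_simps linear_HomD counit_contract)
  show "bimodule_axioms T Cd Md"
    by unfold_locales (auto intro!: extensionalityI[of _ "carrier M"]
        simp: closed closed_maps contract_simps compose_eq)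
qed

lemma bimodule_Q: "bimodule Cd T Q"
proof (intro bimodule.intro left_module.intro right_module.intro ring_T ring_Cd)
  show "abelian_group Q" "abelian_group Q"
    by (rule abelian_group_colinear_Hom[OF comodule_C comodule_M]; simp)+
  show "left_module_axioms Cd Q"
    by unfold_locales (auto intro!: extensionalityI[of _ "carrier C"]
        simp: closed closed_maps additive contract_simps colinear_HomD(1)[of _ _ _ "coring_comodule C", simplified])
  show "right_module_axioms T Q"
    by unfold_locales (auto intro!: extensionalityI[of _ "carrier C"]
        simp: closed closed_maps additive compose_eq colinear_HomD(1)[of _ _ _ "coring_comodule C", simplified])
  show "bimodule_axioms Cd T Q"
    by unfold_locales (auto intro!: extensionalityI[of _ "carrier C"]
        simp: closed closed_maps contract_simps compose_eq)
qed

lemma tau_balanced: "balanced Cd Md Q T (\<lambda>\<phi> q. \<lambda>m\<in>carrier M. q (contract C \<phi> (coact M m)))"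
  by (rule balancedI) (auto intro!: extensionalityI[of _ "carrier M"]
        simp: closed closed_maps contract_simps additive)

lemma mu_balanced: "balanced T Q Md Cd (\<lambda>q \<phi>. compose (carrier C) \<phi> q)"
  by (rule balancedI) (auto intro!: extensionalityI[of _ "carrier C"]
        simp: closed closed_maps compose_eq additive)

lemma tau_elem: "\<lbrakk>\<phi> \<in> carrier Md; q \<in> carrier Q\<rbrakk> \<Longrightarrow>
    tau_map A C M (tensor_elem Cd Md Q \<phi> q) = (\<lambda>m\<in>carrier M. q (contract C \<phi> (coact M m)))"
  unfolding tau_map_def
  using bimodule_Md bimodule_Q ring_T tau_balanced
  by (intro tensor_factors.tensor_lift_elem) (auto simp: tensor_factors_def bimodule_def ring_def)

lemma mu_elem: "\<lbrakk>q \<in> carrier Q; \<phi> \<in> carrier Md\<rbrakk> \<Longrightarrow>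
    mu_map A C M (tensor_elem T Q Md q \<phi>) = compose (carrier C) \<phi> q"
  unfolding mu_map_def
  using bimodule_Md bimodule_Q ring_Cd mu_balanced
  by (intro tensor_factors.tensor_lift_elem) (auto simp: tensor_factors_def bimodule_def ring_def)

lemma morita_context_comodule: "morita_context T Cd Md Q (tau_map A C M) (mu_map A C M)"
proof (intro morita_context.intro morita_context_axioms.intro bimodule_Md bimodule_Q)
  show "bimodule_map T T (tensor_bimodule Cd Md Q) (regular_bimodule T) (tau_map A C M)"
    unfolding tau_map_def
    by (rule bimodule_map_tensor_lift[OF bimodule_Md bimodule_Q ring_T tau_balanced])
      (auto intro!: extensionalityI[of _ "carrier M"] simp: closed closed_maps contract_simps compose_eq)
  show "bimodule_map Cd Cd (tensor_bimodule T Q Md) (regular_bimodule Cd) (mu_map A C M)"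
    unfolding mu_map_def
    by (rule bimodule_map_tensor_lift[OF bimodule_Q bimodule_Md ring_Cd mu_balanced])
      (auto intro!: extensionalityI[of _ "carrier C"] simp: closed closed_maps contract_simps compose_eq
        contract_comp)
next
  fix \<phi> \<psi> q assume "\<phi> \<in> carrier Md" "\<psi> \<in> carrier Md" "q \<in> carrier Q"
  then show "tau_map A C M (tensor_elem Cd Md Q \<phi> q) \<odot>\<^bsub>Md\<^esub> \<psi> = \<phi> \<triangleleft>\<^bsub>Md\<^esub> mu_map A C M (tensor_elem T Q Md q \<psi>)"
    by (subst tau_elem mu_elem; simp)+
      (auto intro!: extensionalityI[of _ "carrier M"] simp: closed closed_maps contract_simps compose_eq)
next
  fix \<phi> q r assume "\<phi> \<in> carrier Md" "q \<in> carrier Q" "r \<in> carrier Q"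
  then show "mu_map A C M (tensor_elem T Q Md q \<phi>) \<odot>\<^bsub>Q\<^esub> r = q \<triangleleft>\<^bsub>Q\<^esub> tau_map A C M (tensor_elem Cd Md Q \<phi> r)"
    by (subst tau_elem mu_elem; simp)+
      (auto intro!: extensionalityI[of _ "carrier C"] simp: closed closed_maps contract_simps compose_eq)
qed

end

theorem theorem4p4:
  fixes A :: "('a, 'z) ring_scheme"
    and C :: "('a, 'c, 'w) coring_scheme"
    and M :: "('a, 'c, 'm, 'x) comodule_scheme"
  assumes "ring A" and "coring A C" and "left_comodule A C M"
  defines "T \<equiv> T_ring A C M"
    and "Cd \<equiv> left_dual_ring A C"
    and "Md \<equiv> dual_bimodule A C M"
    and "Q \<equiv> Q_bimodule A C M"
    and "\<tau> \<equiv> tau_map A C M"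
    and "\<mu> \<equiv> mu_map A C M"
  shows "morita_context T Cd Md Q \<tau> \<mu>
    \<and> (\<forall>\<phi>\<in>carrier Md. \<forall>q\<in>carrier Q. \<forall>m\<in>carrier M.
         \<tau> (tensor_elem Cd Md Q \<phi> q) m = q (contract C \<phi> (coact M m)))
    \<and> (\<forall>q\<in>carrier Q. \<forall>\<phi>\<in>carrier Md. \<forall>c\<in>carrier C.
         \<mu> (tensor_elem T Q Md q \<phi>) c = \<phi> (q c))"
proof -
  interpret left_comodule A C M by (rule \<open>left_comodule A C M\<close>)
  show ?thesis
    unfolding T_def Cd_def Md_def Q_def \<tau>_def \<mu>_def
    using morita_context_comodule tau_elem mu_elem by (simp add: compose_eq)
qed

end
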